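(* Let $L\ge 2$, and let $$H'=-\sum_p\big(J^X_p+J^X_pA_p+J^Z_p+J^Z_pB_p\big),\qquad H''=-\sum_p\big(J^X_p+J^Z_p+A_p+B_p\big),$$ with the operators defined in the context. Then $H'$ and $H''$ have the same ground subspace, and for every $0\le t\le 1$ the Hamiltonian $(1-t)H'+tH''$ has an energy gap (above that same ground subspace) of at least $4(\sqrt2-1)$. In particular $H'$ can be continuously deformed to $H''$ without closing the gap.
   Context: There are $L^2$ labels $p$. The system consists of $2L^2$ toric code qubits, located at the edges of a periodic square lattice with $L^2$ vertices and $L^2$ faces, and $L^2$ ancillary qubits, one per label $p$. $J^X_p$ and $J^Z_p$ are the Pauli operators $X$ and $Z$ on the ancillary qubit $p$. $\{A_p\}_p$ are the star operators $\prod_{e\ni v}X_e$, one for each vertex $v$, and $\{B_p\}_p$ are the plaquette operators $\prod_{e\in\partial f}Z_e$, one for each face $f$, of Kitaev's toric code (vertices and faces are each put in bijection with the labels $p$). $H'$ is the image, under a constant-depth circuit of local CNOT gates, of the subsystem toric code Hamiltonian $-\sum_T G(T)$; $H''$ is the ordinary toric code Hamiltonian together with decoupled ancillary qubits. The energy gap is the difference between the lowest eigenvalue and the next distinct eigenvalue. *)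

theory Defs
  imports
    Complex_Main
    "Jordan_Normal_Form.Spectral_Radius"
    "Jordan_Normal_Form.Schur_Decomposition"
begin

section \<open>Operators on a register of qubits\<close>

definition pauli_X :: "complex mat" where
  "pauli_X = mat_of_rows_list 2 [[0, 1], [1, 0]]"

definition pauli_Z :: "complex mat" where
  "pauli_Z = mat_of_rows_list 2 [[1, 0], [0, -1]]"

text \<open>
  The state space of \<open>n\<close> qubits has the computational basis indexed by \<open>{..<2 ^ n}\<close>: in the
  basis state \<open>i\<close>, qubit \<open>k\<close> is in the state given by binary digit \<open>k\<close> of \<open>i\<close>.  In this basis
  the matrix below is the tensor product of the \<open>2 \<times> 2\<close> matrix \<open>U\<close> in factor \<open>k\<close> with
  identity matrices in all the other factors.
\<close>
definition on_qubit :: "nat \<Rightarrow> complex mat \<Rightarrow> nat \<Rightarrow> complex mat" where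
  "on_qubit n U k = mat (2 ^ n) (2 ^ n) (\<lambda>(i, j).
     if \<forall>m<n. m \<noteq> k \<longrightarrow> bit i m = bit j m
     then U $$ (of_bool (bit i k), of_bool (bit j k)) else 0)"

definition mat_sum :: "nat \<Rightarrow> ('i \<Rightarrow> complex mat) \<Rightarrow> 'i set \<Rightarrow> complex mat" where
  "mat_sum N M I = mat N N (\<lambda>(i, j). \<Sum>p\<in>I. M p $$ (i, j))"

section \<open>Spectral gap\<close>

definition self_adjoint :: "complex mat \<Rightarrow> bool" where
  "self_adjoint H \<longleftrightarrow> square_mat H \<and> mat_adjoint H = H"

text \<open>Only real eigenvalues are collected; for a self-adjoint matrix these are all of them.\<close>
definition energies :: "complex mat \<Rightarrow> real set" where
  "energies H = {E. complex_of_real E \<in> spectrum H}"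

definition ground_energy :: "complex mat \<Rightarrow> real" where
  "ground_energy H = Min (energies H)"

definition ground_space :: "complex mat \<Rightarrow> complex vec set" where
  "ground_space H =
     {v \<in> carrier_vec (dim_row H). H *\<^sub>v v = complex_of_real (ground_energy H) \<cdot>\<^sub>v v}"

definition excited_energies :: "complex mat \<Rightarrow> real set" where
  "excited_energies H = energies H - {ground_energy H}"

text \<open>Meaningful only if \<open>excited_energies H \<noteq> {}\<close>, since \<open>Min {}\<close> is unspecified.\<close>
definition energy_gap :: "complex mat \<Rightarrow> real" where
  "energy_gap H = Min (excited_energies H) - ground_energy H"

definition gap_at_least :: "real \<Rightarrow> complex mat \<Rightarrow> bool" where
  "gap_at_least \<delta> H \<longleftrightarrow> excited_energies H \<noteq> {} \<and> energy_gap H \<ge> \<delta>"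

text \<open>
  The gap stays open along a path of Hamiltonians if it is bounded below by a positive constant.
  Continuity in a finite-dimensional matrix space is continuity of every entry.
\<close>
definition deformable_without_closing_gap :: "complex mat \<Rightarrow> complex mat \<Rightarrow> bool" where
  "deformable_without_closing_gap H\<^sub>0 H\<^sub>1 \<longleftrightarrow>
     (\<exists>(\<gamma> :: real \<Rightarrow> complex mat) N.
        (\<forall>s\<in>{0..1}. \<gamma> s \<in> carrier_mat N N \<and> self_adjoint (\<gamma> s)) \<and>
        (\<forall>i<N. \<forall>j<N. continuous_on {0..1} (\<lambda>s. \<gamma> s $$ (i, j))) \<and>
        \<gamma> 0 = H\<^sub>0 \<and> \<gamma> 1 = H\<^sub>1 \<and>
        (\<exists>\<delta>>0. \<forall>s\<in>{0..1}. gap_at_least \<delta> (\<gamma> s)))"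

section \<open>The toric code with ancillas\<close>

text \<open>
  Vertices and faces of the periodic \<open>L \<times> L\<close> square lattice are both given by coordinates in
  \<open>{..<L} \<times> {..<L}\<close>.  The horizontal edge at \<open>(x, y)\<close> joins the vertices \<open>(x, y)\<close> and
  \<open>(x + 1, y)\<close>, the vertical edge at \<open>(x, y)\<close> joins \<open>(x, y)\<close> and \<open>(x, y + 1)\<close>, and the face
  \<open>(x, y)\<close> has corners \<open>(x, y)\<close>, \<open>(x + 1, y)\<close>, \<open>(x, y + 1)\<close>, \<open>(x + 1, y + 1)\<close>, coordinates
  taken modulo \<open>L\<close>.  The labels are \<open>{..<L\<^sup>2}\<close>.

  The \<open>3 L\<^sup>2\<close> qubits are numbered with the horizontal edges first, then the vertical edges, then
  the ancillas.
\<close>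
definition hor_edge :: "nat \<Rightarrow> nat \<Rightarrow> nat \<Rightarrow> nat" where
  "hor_edge L x y = x mod L + L * (y mod L)"

definition ver_edge :: "nat \<Rightarrow> nat \<Rightarrow> nat \<Rightarrow> nat" where
  "ver_edge L x y = L\<^sup>2 + (x mod L + L * (y mod L))"

definition ancilla :: "nat \<Rightarrow> nat \<Rightarrow> nat" where
  "ancilla L p = 2 * L\<^sup>2 + p"

definition num_qubits :: "nat \<Rightarrow> nat" where
  "num_qubits L = 3 * L\<^sup>2"

definition hilbert_dim :: "nat \<Rightarrow> nat" where
  "hilbert_dim L = 2 ^ num_qubits L"

abbreviation X_at :: "nat \<Rightarrow> nat \<Rightarrow> complex mat" where
  "X_at L \<equiv> on_qubit (num_qubits L) pauli_X"

abbreviation Z_at :: "nat \<Rightarrow> nat \<Rightarrow> complex mat" where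
  "Z_at L \<equiv> on_qubit (num_qubits L) pauli_Z"

text \<open>
  In the star, \<open>x + L - 1\<close> stands for \<open>x - 1\<close> modulo \<open>L\<close>.  For \<open>L \<ge> 2\<close> the four edges of a star,
  and the four edges of a plaquette, are distinct.
\<close>
definition star_op :: "nat \<Rightarrow> nat \<times> nat \<Rightarrow> complex mat" where
  "star_op L = (\<lambda>(x, y).
     X_at L (hor_edge L x y) * X_at L (hor_edge L (x + L - 1) y) *
     X_at L (ver_edge L x y) * X_at L (ver_edge L x (y + L - 1)))"

definition plaquette_op :: "nat \<Rightarrow> nat \<times> nat \<Rightarrow> complex mat" where
  "plaquette_op L = (\<lambda>(x, y).
     Z_at L (hor_edge L x y) * Z_at L (hor_edge L x (y + 1)) *
     Z_at L (ver_edge L x y) * Z_at L (ver_edge L (x + 1) y))"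

definition JX :: "nat \<Rightarrow> nat \<Rightarrow> complex mat" where
  "JX L p = X_at L (ancilla L p)"

definition JZ :: "nat \<Rightarrow> nat \<Rightarrow> complex mat" where
  "JZ L p = Z_at L (ancilla L p)"

text \<open>
  The parameters \<open>vtx\<close> and \<open>face\<close> are the identifications of the labels with the vertices and
  with the faces; \<open>H1\<close> and \<open>H2\<close> are the Hamiltonians $H'$ and $H''$.
\<close>
definition H1 :: "nat \<Rightarrow> (nat \<Rightarrow> nat \<times> nat) \<Rightarrow> (nat \<Rightarrow> nat \<times> nat) \<Rightarrow> complex mat" where
  "H1 L vtx face = - mat_sum (hilbert_dim L) (\<lambda>p.
     JX L p + JX L p * star_op L (vtx p) + JZ L p + JZ L p * plaquette_op L (face p)) {..<L\<^sup>2}"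

definition H2 :: "nat \<Rightarrow> (nat \<Rightarrow> nat \<times> nat) \<Rightarrow> (nat \<Rightarrow> nat \<times> nat) \<Rightarrow> complex mat" where
  "H2 L vtx face = - mat_sum (hilbert_dim L) (\<lambda>p.
     JX L p + JZ L p + star_op L (vtx p) + plaquette_op L (face p)) {..<L\<^sup>2}"

definition H_interp ::
    "nat \<Rightarrow> (nat \<Rightarrow> nat \<times> nat) \<Rightarrow> (nat \<Rightarrow> nat \<times> nat) \<Rightarrow> real \<Rightarrow> complex mat" where
  "H_interp L vtx face t =
     complex_of_real (1 - t) \<cdot>\<^sub>m H1 L vtx face + complex_of_real t \<cdot>\<^sub>m H2 L vtx face"

end

(*
All star operators A_p and plaquette operators B_p commute with each other and with the
Hamiltonian at every t.  In a joint eigenspace with signs a_p, b_p the Hamiltonian decouples into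
  - sum_p (t (a_p + b_p) + (1 + (1 - t) a_p) X_p + (1 + (1 - t) b_p) Z_p),
and (1 + (1 - t) a) X + (1 + (1 - t) b) Z is site_radius t a b times an involution.  So the energies
are read off from signs a_p, b_p, k_p.  The ground state has all signs 1.  Flipping one a_p or b_p
alone costs only 2 (sqrt 2 - 1) at t = 0, but the product of all A_p and the product of all B_p are
the identity, so flipped signs come in pairs.  The involution at a site with a_p = b_p = 1 is
(X_p + Z_p) / sqrt 2 for every t, hence the ground space does not depend on t.
*)
theory Submission
  imports Defs "HOL-Library.Function_Algebras"
begin

text \<open>The register is never split into tensor factors. An eigenvector of the Hamiltonian is
  refined by maps \<open>1 + T\<close> and \<open>1 - T\<close>, for involutions \<open>T\<close>,
  until its signs can be read off. This bounds every energy without deciding which sign patterns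
  occur. Only two are shown to occur: the ground state, and one ancilla excitation, because a gap is
  meaningful only if some excited energy exists.

  The obstacle is that the involution at a site points in a direction depending on
  \<open>a_p\<close> and \<open>b_p\<close>, so a fixed choice of it need not commute with the
  Hamiltonian as a whole. It can be diagonalized only after the star and plaquette signs are fixed,
  and the ground space has to be determined in the same two stages.

  That two defects keep their cost for all t rests on convexity: the length of the site field is
  convex in t, so it stays below its chord.\<close>

section \<open>Joint eigenvectors of commuting involutions\<close>

text \<open>
  Refining \<open>v\<close> to \<open>w\<close> keeps every eigenvalue equation already known for \<open>v\<close>, in particular
  that of the Hamiltonian.
\<close>
definition inherits_eigenvalues ::
    "('p \<Rightarrow> 'v \<Rightarrow> 'v) \<Rightarrow> 'v::real_vector \<Rightarrow> 'v \<Rightarrow> bool" where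
  "inherits_eigenvalues T v w \<longleftrightarrow>
    (\<forall>Q c. linear Q \<longrightarrow> (\<forall>p x. Q (T p x) = T p (Q x)) \<longrightarrow> Q v = c *\<^sub>R v \<longrightarrow> Q w = c *\<^sub>R w)"

lemma inherits_eigenvaluesD:
  assumes "inherits_eigenvalues T v w" "linear Q" "\<And>p x. Q (T p x) = T p (Q x)" "Q v = c *\<^sub>R v"
  shows "Q w = c *\<^sub>R w"
  using assms unfolding inherits_eigenvalues_def by blast

text \<open>The vector \<open>w\<close> arises from \<open>v\<close> by applying one of
  \<open>1 + T p\<close> and \<open>1 - T p\<close> for each \<open>p\<close> in turn. Whatever
  commutes with all \<open>T p\<close> therefore keeps its eigenvalue.\<close>

lemma involution_refinement:
  fixes T :: "'p \<Rightarrow> 'v::real_vector \<Rightarrow> 'v"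
  assumes "finite S"
    and lin: "\<And>p. linear (T p)"
    and inv: "\<And>p x. T p (T p x) = x"
    and comm: "\<And>p q x. T p (T q x) = T q (T p x)"
    and "v \<noteq> 0"
  obtains w and a :: "'p \<Rightarrow> real" where "w \<noteq> 0"
    and "\<And>p. p \<in> S \<Longrightarrow> a p = 1 \<or> a p = -1" "\<And>p. p \<in> S \<Longrightarrow> T p w = a p *\<^sub>R w"
    and "inherits_eigenvalues T v w"
proof -
  have "\<exists>a w. w \<noteq> 0 \<and> (\<forall>p\<in>S. (a p = 1 \<or> a p = -1) \<and> T p w = (a p :: real) *\<^sub>R w) \<and> inherits_eigenvalues T v w"
    using assms(1)
  proof (induction S)
    case empty
    have "inherits_eigenvalues T v v" by (simp add: inherits_eigenvalues_def)
    then show ?case using \<open>v \<noteq> 0\<close> by blast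
  next
    case (insert q S)
    then obtain a w where w: "w \<noteq> 0" "\<forall>p\<in>S. (a p = 1 \<or> a p = -1) \<and> T p w = (a p :: real) *\<^sub>R w"
      "inherits_eigenvalues T v w" by blast
    \<comment> \<open>The two candidates \<open>w + T q w\<close> and \<open>w - T q w\<close> add
      up to twice \<open>w\<close>, so they cannot both vanish.\<close>
    obtain s :: real where s: "s = 1 \<or> s = -1" "w + s *\<^sub>R T q w \<noteq> 0"
    proof (cases "w + T q w = 0")
      case True
      then have "T q w = - w" by (simp add: add_eq_0_iff)
      then have "w + (-1) *\<^sub>R T q w = 2 *\<^sub>R w" by (simp add: scaleR_2)
      then show ?thesis using that[of "-1"] w(1) by simp
    next
      case False
      then show ?thesis using that[of 1] by simp
    qed
    define u where "u = w + s *\<^sub>R T q w"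
    have eig: "Q' u = c *\<^sub>R u" if "linear Q'" "Q' w = c *\<^sub>R w" "\<And>x. Q' (T q x) = T q (Q' x)" for Q' c
      using that lin[of q] by (simp add: u_def linear_add linear_scale algebra_simps)
    have "s * s = 1" using s by auto
    then have "T q u = s *\<^sub>R u"
      using lin[of q] by (simp add: u_def linear_add linear_scale inv algebra_simps)
    moreover have "T p u = a p *\<^sub>R u" if "p \<in> S" for p
      using that w(2) comm by (intro eig lin) auto
    ultimately have "\<forall>p\<in>insert q S. ((a(q:=s)) p = 1 \<or> (a(q:=s)) p = -1) \<and> T p u = ((a(q:=s)) p) *\<^sub>R u"
      using s w(2) insert.hyps by auto
    moreover have "inherits_eigenvalues T v u"
      using w(3) eig unfolding inherits_eigenvalues_def by blast
    moreover have "u \<noteq> 0" using s(2) by (simp add: u_def)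
    ultimately show ?case by blast
  qed
  then show ?thesis using that by blast
qed

section \<open>The energy of a single site\<close>

lemma sign_defect_even:
  fixes a :: "'p \<Rightarrow> real"
  assumes "finite P" "\<And>p. p \<in> P \<Longrightarrow> a p = 1 \<or> a p = -1" "(\<Prod>p\<in>P. a p) = 1" "q \<in> P" "a q = -1"
  shows "\<exists>r\<in>P. r \<noteq> q \<and> a r = -1"
proof (rule ccontr)
  assume "\<not> ?thesis"
  then have "\<And>p. p \<in> P - {q} \<Longrightarrow> a p = 1" using assms(2) by blast
  then have "(\<Prod>p\<in>P. a p) = -1" using assms(1,4,5) by (simp add: prod.remove)
  then show False using assms(3) by simp
qed

definition site_radius :: "real \<Rightarrow> real \<Rightarrow> real \<Rightarrow> real" where
  "site_radius t a b = sqrt ((1 + (1 - t) * a)\<^sup>2 + (1 + (1 - t) * b)\<^sup>2)"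

text \<open>This is \<open>t * (a + b) + site_radius t a b * k\<close> at
  \<open>a = b = k = 1\<close>, that is, minus the ground energy per label.\<close>

definition site_top :: "real \<Rightarrow> real" where
  "site_top t = 2 * t + (2 - t) * sqrt 2"

definition site_loss :: "real \<Rightarrow> real \<Rightarrow> real \<Rightarrow> real \<Rightarrow> real" where
  "site_loss t a b k = site_top t - (t * (a + b) + site_radius t a b * k)"

lemma site_radius_11: "t \<le> 1 \<Longrightarrow> site_radius t 1 1 = (2 - t) * sqrt 2"
proof -
  assume "t \<le> 1"
  have "site_radius t 1 1 = sqrt ((2 - t)\<^sup>2 * 2)"
    unfolding site_radius_def by (rule arg_cong[where f=sqrt]) (simp add: algebra_simps power2_eq_square)
  then show ?thesis using \<open>t \<le> 1\<close> by (simp add: real_sqrt_mult)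
qed

lemma sqrt2_bounds: "7/5 < sqrt 2" "sqrt 2 < 3/2"
proof -
  show "7/5 < sqrt 2" by (rule real_less_rsqrt) (simp add: power2_eq_square)
  show "sqrt 2 < 3/2" by (rule real_less_lsqrt) (simp_all add: power2_eq_square)
qed

text \<open>As the norm of an affine function, the radius is convex in \<open>t\<close>. The
  right-hand side is its chord from the value 2 at \<open>t = 0\<close> to \<open>sqrt 2\<close> at
  \<open>t = 1\<close>.\<close>

lemma site_radius_mixed:
  assumes "0 \<le> t" "t \<le> 1"
  shows "site_radius t 1 (-1) \<le> 2 - t * (2 - sqrt 2)" "site_radius t (-1) 1 \<le> 2 - t * (2 - sqrt 2)"
proof -
  have s: "sqrt 2 * sqrt 2 = 2" by simp
  have "(2 - t)\<^sup>2 + t\<^sup>2 \<le> (2 - t * (2 - sqrt 2))\<^sup>2"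
  proof -
    have "(2 - t * (2 - sqrt 2))\<^sup>2 - ((2 - t)\<^sup>2 + t\<^sup>2) = 4 * (sqrt 2 - 1) * (t * (1 - t))"
      using s by (simp add: power2_eq_square algebra_simps)
    also have "\<dots> \<ge> 0" using assms sqrt2_bounds by simp
    finally show ?thesis by simp
  qed
  moreover have "0 \<le> 2 - t * (2 - sqrt 2)"
    using assms sqrt2_bounds mult_mono[of t 1 "2 - sqrt 2" 2] by simp
  ultimately have *: "sqrt ((2 - t)\<^sup>2 + t\<^sup>2) \<le> 2 - t * (2 - sqrt 2)"
    using real_le_lsqrt by blast
  then show "site_radius t 1 (-1) \<le> 2 - t * (2 - sqrt 2)"
    unfolding site_radius_def by (simp add: algebra_simps)
  from * show "site_radius t (-1) 1 \<le> 2 - t * (2 - sqrt 2)"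
    unfolding site_radius_def by (simp add: algebra_simps)
qed

lemma site_loss_bounds:
  assumes t: "0 \<le> t" "t \<le> 1"
    and signs: "a = 1 \<or> a = -1" "b = 1 \<or> b = -1" "k = 1 \<or> k = -1"
  shows "0 \<le> site_loss t a b k"
    and "a = -1 \<or> b = -1 \<Longrightarrow> 2 * (sqrt 2 - 1) \<le> site_loss t a b k"
    and "a = 1 \<Longrightarrow> b = 1 \<Longrightarrow> k = -1 \<Longrightarrow> 4 * (sqrt 2 - 1) \<le> site_loss t a b k"
    and "a = 1 \<Longrightarrow> b = 1 \<Longrightarrow> k = 1 \<Longrightarrow> site_loss t a b k = 0"
proof -
  have rk: "site_radius t a b * k \<le> site_radius t a b"
    using signs(3) by (auto simp: site_radius_def)
  have r: "site_radius t (-1) (-1) = t * sqrt 2"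
    using t by (simp add: site_radius_def real_sqrt_mult power2_eq_square flip: mult_2)
  have ts: "t * (7/5) \<le> t * sqrt 2" "t * sqrt 2 \<le> t * (3/2)" "t * sqrt 2 \<le> 1 * sqrt 2"
    using mult_left_mono[OF less_imp_le[OF sqrt2_bounds(1)] t(1)]
      mult_left_mono[OF less_imp_le[OF sqrt2_bounds(2)] t(1)] mult_right_mono[OF t(2), of "sqrt 2"] by simp_all
  show 2: "2 * (sqrt 2 - 1) \<le> site_loss t a b k" if ab: "a = -1 \<or> b = -1"
  proof -
    \<comment> \<open>In the mixed cases the chord bound gives a loss of at least
      \<open>2 * (sqrt 2 - 1) + 2 * t * (2 - sqrt 2)\<close>. With both signs flipped the radius is
      \<open>t * sqrt 2\<close>, and the loss is at least
      \<open>2 * sqrt 2 + 2 * t * (2 - sqrt 2)\<close>.\<close>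
    consider "a = -1" "b = -1" | "a = 1" "b = -1" | "a = -1" "b = 1" using ab signs by auto
    then show ?thesis
      by cases (use rk r site_radius_mixed[OF t] ts t sqrt2_bounds in
        \<open>simp_all add: site_loss_def site_top_def algebra_simps\<close>)
  qed
  show 4: "site_loss t a b k = 0" if "a = 1" "b = 1" "k = 1"
    using that site_radius_11[OF t(2)] by (simp add: site_loss_def site_top_def)
  \<comment> \<open>Here the loss is \<open>2 * (2 - t) * sqrt 2\<close>, which is at least
    \<open>2 * sqrt 2\<close>.\<close>
  show 3: "4 * (sqrt 2 - 1) \<le> site_loss t a b k" if "a = 1" "b = 1" "k = -1"
    using that site_radius_11[OF t(2)] ts t sqrt2_bounds
    by (simp add: site_loss_def site_top_def algebra_simps)
  show "0 \<le> site_loss t a b k"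
  proof (cases "a = -1 \<or> b = -1")
    case True
    then show ?thesis using 2[OF True] sqrt2_bounds by argo
  next
    case False
    then have "a = 1" "b = 1" using signs by auto
    then show ?thesis using 3[OF \<open>a = 1\<close> \<open>b = 1\<close>] 4[OF \<open>a = 1\<close> \<open>b = 1\<close>] signs(3) sqrt2_bounds by fastforce
  qed
qed

text \<open>A flipped star or plaquette sign forces another of its family at a different label, so
  two sites each lose half of the bound. In the absence of such flips, a single site with
  \<open>k p = -1\<close> already loses all of it.\<close>

lemma total_loss_cases:
  fixes a b k :: "'p \<Rightarrow> real"
  assumes t: "0 \<le> t" "t \<le> 1" and P: "finite P"
    and signs: "\<And>p. p \<in> P \<Longrightarrow> a p = 1 \<or> a p = -1" "\<And>p. p \<in> P \<Longrightarrow> b p = 1 \<or> b p = -1"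
      "\<And>p. p \<in> P \<Longrightarrow> k p = 1 \<or> k p = -1"
    and prods: "(\<Prod>p\<in>P. a p) = 1" "(\<Prod>p\<in>P. b p) = 1"
  defines "D \<equiv> (\<Sum>p\<in>P. site_loss t (a p) (b p) (k p))"
  shows "D \<ge> 4 * (sqrt 2 - 1) \<or> (D = 0 \<and> (\<forall>p\<in>P. a p = 1 \<and> b p = 1 \<and> k p = 1))"
proof -
  let ?d = "\<lambda>p. site_loss t (a p) (b p) (k p)"
  have nn: "\<And>p. p \<in> P \<Longrightarrow> 0 \<le> ?d p" using site_loss_bounds(1)[OF t signs] .
  have two: "D \<ge> 4 * (sqrt 2 - 1)"
    if "p \<in> P" "q \<in> P" "p \<noteq> q" "a p = -1 \<or> b p = -1" "a q = -1 \<or> b q = -1" for p q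
  proof -
    have "4 * (sqrt 2 - 1) \<le> ?d p + ?d q"
      using site_loss_bounds(2)[OF t signs[OF that(1)]] site_loss_bounds(2)[OF t signs[OF that(2)]] that(4,5)
      by auto
    also have "\<dots> = (\<Sum>x\<in>{p, q}. ?d x)" using that(3) by simp
    also have "\<dots> \<le> D" unfolding D_def using that nn by (intro sum_mono2[OF P]) auto
    finally show ?thesis .
  qed
  show ?thesis
  proof (cases "\<exists>p\<in>P. a p = -1 \<or> b p = -1")
    case True
    then obtain p where p: "p \<in> P" "a p = -1 \<or> b p = -1" by blast
    then obtain q where "q \<in> P" "q \<noteq> p" "a q = -1 \<or> b q = -1"
      using sign_defect_even[OF P signs(1) prods(1) p(1)] sign_defect_even[OF P signs(2) prods(2) p(1)] by blast
    then show ?thesis using two p by blast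
  next
    case False
    then have ab: "\<forall>p\<in>P. a p = 1 \<and> b p = 1" using signs by blast
    show ?thesis
    proof (cases "\<exists>p\<in>P. k p = -1")
      case True
      then obtain p where p: "p \<in> P" "k p = -1" by blast
      have "4 * (sqrt 2 - 1) \<le> ?d p" using site_loss_bounds(3)[OF t signs[OF p(1)]] ab p by blast
      also have "\<dots> \<le> D" unfolding D_def using member_le_sum[OF p(1), of ?d] nn P by auto
      finally show ?thesis by blast
    next
      case False
      then have "\<forall>p\<in>P. k p = 1" using signs by blast
      then show ?thesis using ab site_loss_bounds(4)[OF t] by (auto simp: D_def intro!: sum.neutral)
    qed
  qed
qed

section \<open>Stabilizer Hamiltonians\<close>

text \<open>Real scalars suffice because all coefficients and signs are real. The global relations
  \<open>prod_A\<close> and \<open>prod_B\<close> are stated for joint eigenvalues, which is the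
  form that the counting of signs uses.\<close>

locale stabilizer_hamiltonian =
  fixes P :: "'p set" and X Z A B :: "'p \<Rightarrow> 'v::real_vector \<Rightarrow> 'v"
  assumes finite_P: "finite P"
    and linear_ops: "linear (X p)" "linear (Z p)" "linear (A p)" "linear (B p)"
    and square: "X p (X p v) = v" "Z p (Z p v) = v" "A p (A p v) = v" "B p (B p v) = v"
    and commute: "X p (X q v) = X q (X p v)" "Z p (Z q v) = Z q (Z p v)"
      "A p (A q v) = A q (A p v)" "B p (B q v) = B q (B p v)" "A p (B q v) = B q (A p v)"
      "A p (X q v) = X q (A p v)" "A p (Z q v) = Z q (A p v)"
      "B p (X q v) = X q (B p v)" "B p (Z q v) = Z q (B p v)"
    and commute_XZ: "p \<noteq> q \<Longrightarrow> X p (Z q v) = Z q (X p v)"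
    and anticommute_XZ: "X p (Z p v) = - Z p (X p v)"
    and prod_A: "v \<noteq> 0 \<Longrightarrow> (\<And>p. p \<in> P \<Longrightarrow> A p v = a p *\<^sub>R v) \<Longrightarrow> (\<Prod>p\<in>P. a p) = 1"
    and prod_B: "v \<noteq> 0 \<Longrightarrow> (\<And>p. p \<in> P \<Longrightarrow> B p v = a p *\<^sub>R v) \<Longrightarrow> (\<Prod>p\<in>P. a p) = 1"
begin

definition Ham :: "real \<Rightarrow> 'v \<Rightarrow> 'v" where
  "Ham t v = - (\<Sum>p\<in>P. (1 - t) *\<^sub>R (X p v + X p (A p v) + Z p v + Z p (B p v))
                       + t *\<^sub>R (X p v + Z p v + A p v + B p v))"

section \<open>Combinations of X and Z at one site\<close>

definition K :: "real \<Rightarrow> real \<Rightarrow> 'p \<Rightarrow> 'v \<Rightarrow> 'v" where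
  "K c s p v = c *\<^sub>R X p v + s *\<^sub>R Z p v"

abbreviation K0 :: "'p \<Rightarrow> 'v \<Rightarrow> 'v" where
  "K0 \<equiv> K (1 / sqrt 2) (1 / sqrt 2)"

lemmas linear_add_ops = linear_ops[THEN linear_add]
lemmas linear_diff_ops = linear_ops[THEN linear_diff]
lemmas linear_neg_ops = linear_ops[THEN linear_neg]
lemmas linear_scale_ops = linear_ops[THEN linear_scale]

lemma linear_K: "linear (K c s p)"
  by (rule linearI) (simp_all add: K_def linear_add_ops linear_scale_ops algebra_simps)

lemma K_commute: "p \<noteq> q \<Longrightarrow> K c s p (K c' s' q v) = K c' s' q (K c s p v)"
  using commute_XZ[of p q] commute_XZ[of q p]
  by (simp add: K_def linear_add_ops linear_scale_ops algebra_simps commute(1)[of p q] commute(2)[of p q])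

text \<open>The cross terms cancel because \<open>X p\<close> and \<open>Z p\<close>
  anticommute.\<close>

lemma K_square: "c\<^sup>2 + s\<^sup>2 = 1 \<Longrightarrow> K c s p (K c s p v) = v"
proof -
  assume "c\<^sup>2 + s\<^sup>2 = 1"
  have "K c s p (K c s p v) = (c\<^sup>2 + s\<^sup>2) *\<^sub>R v"
    by (simp add: K_def linear_add_ops linear_scale_ops algebra_simps square anticommute_XZ power2_eq_square)
  then show ?thesis using \<open>c\<^sup>2 + s\<^sup>2 = 1\<close> by simp
qed

lemma K0_square: "K0 p (K0 p v) = v"
  by (rule K_square) (simp add: power_divide)

lemma K_family_commute: "K (c p) (s p) p (K (c q) (s q) q v) = K (c q) (s q) q (K (c p) (s p) p v)"
  by (cases "p = q") (simp_all add: K_commute)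

lemma K0_commute: "K0 p (K0 q v) = K0 q (K0 p v)"
  by (cases "p = q") (simp_all add: K_commute)

lemma A_K: "A q (K c s p v) = K c s p (A q v)" and B_K: "B q (K c s p v) = K c s p (B q v)"
  by (simp_all add: K_def linear_add_ops linear_scale_ops commute)

section \<open>The Hamiltonian in a sector of fixed star and plaquette signs\<close>

definition site_term :: "real \<Rightarrow> 'p \<Rightarrow> 'v \<Rightarrow> 'v" where
  "site_term t p v = (1 - t) *\<^sub>R (X p v + X p (A p v) + Z p v + Z p (B p v))
    + t *\<^sub>R (X p v + Z p v + A p v + B p v)"

lemma Ham_sum: "Ham t v = - (\<Sum>p\<in>P. site_term t p v)"
  by (simp add: Ham_def site_term_def)

lemma linear_site_term: "linear (site_term t p)"
  by (rule linearI) (simp_all add: site_term_def linear_add_ops linear_scale_ops algebra_simps)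

lemma linear_Ham: "linear (Ham t)"
  by (rule linearI)
    (simp_all add: Ham_sum linear_add[OF linear_site_term] linear_scale[OF linear_site_term] sum.distrib scaleR_right.sum)

lemma neg_sum_linear:
  assumes "linear f" shows "f (- (\<Sum>p\<in>S. g p)) = - (\<Sum>p\<in>S. f (g p))"
  using assms by (simp add: linear_neg linear_sum)

lemma A_site_term: "A q (site_term t p v) = site_term t p (A q v)"
  by (simp add: site_term_def linear_add_ops linear_scale_ops commute(5,6,7) commute(3)[of q])

lemma B_site_term: "B q (site_term t p v) = site_term t p (B q v)"
  by (simp add: site_term_def linear_add_ops linear_scale_ops commute(8,9) commute(4)[of q] commute(5)[symmetric])

lemma A_Ham: "A q (Ham t v) = Ham t (A q v)"
  unfolding Ham_sum neg_sum_linear[OF linear_ops(3)] A_site_term ..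

lemma B_Ham: "B q (Ham t v) = Ham t (B q v)"
  unfolding Ham_sum neg_sum_linear[OF linear_ops(4)] B_site_term ..

lemma site_direction: "\<exists>c s. c\<^sup>2 + s\<^sup>2 = 1 \<and> 1 + (1 - t) * a = site_radius t a b * c \<and> 1 + (1 - t) * b = site_radius t a b * s"
proof (cases "site_radius t a b = 0")
  \<comment> \<open>A vanishing radius does occur, at \<open>t = 0\<close> and
    \<open>a = b = -1\<close>. Any unit direction then serves.\<close>
  case True
  then have "1 + (1 - t) * a = 0 \<and> 1 + (1 - t) * b = 0"
    by (simp add: site_radius_def sum_power2_eq_zero_iff)
  then show ?thesis using True by (intro exI[of _ 1] exI[of _ 0]) simp
next
  case False
  let ?r = "site_radius t a b"
  have "?r\<^sup>2 = (1 + (1 - t) * a)\<^sup>2 + (1 + (1 - t) * b)\<^sup>2" by (simp add: site_radius_def)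
  then have "((1 + (1 - t) * a) / ?r)\<^sup>2 + ((1 + (1 - t) * b) / ?r)\<^sup>2 = 1"
    using False by (metis (no_types, lifting) add_divide_distrib power_divide divide_self power_not_zero)
  moreover have "x = ?r * (x / ?r)" for x using False by simp
  ultimately show ?thesis by blast
qed

lemma Ham_sector:
  assumes "\<And>p. p \<in> P \<Longrightarrow> A p v = a p *\<^sub>R v" "\<And>p. p \<in> P \<Longrightarrow> B p v = b p *\<^sub>R v"
    and "\<And>p. p \<in> P \<Longrightarrow> 1 + (1 - t) * a p = r p * c p" "\<And>p. p \<in> P \<Longrightarrow> 1 + (1 - t) * b p = r p * s p"
  shows "Ham t v = - (\<Sum>p\<in>P. (t * (a p + b p)) *\<^sub>R v + r p *\<^sub>R K (c p) (s p) p v)"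
  unfolding Ham_def
proof (intro arg_cong[where f=uminus] sum.cong refl)
  fix p assume p: "p \<in> P"
  have "r p *\<^sub>R K (c p) (s p) p v = (1 + (1 - t) * a p) *\<^sub>R X p v + (1 + (1 - t) * b p) *\<^sub>R Z p v"
    using assms(3,4)[OF p] by (simp add: K_def scaleR_add_right)
  then show "(1 - t) *\<^sub>R (X p v + X p (A p v) + Z p v + Z p (B p v)) + t *\<^sub>R (X p v + Z p v + A p v + B p v)
    = (t * (a p + b p)) *\<^sub>R v + r p *\<^sub>R K (c p) (s p) p v"
    using assms(1,2)[OF p] by (simp add: linear_scale_ops algebra_simps)
qed

text \<open>The last conjunct says that refinement does not change a sign that \<open>v\<close>
  already has. It lets an eigenvector known to be odd under some \<open>A p\<close> or
  \<open>B p\<close> be excluded from the ground energy.\<close>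

lemma energy_decomposition:
  assumes v: "v \<noteq> 0" "Ham t v = E *\<^sub>R v"
  shows "\<exists>a b k. (\<forall>p\<in>P. (a p = 1 \<or> a p = -1) \<and> (b p = 1 \<or> b p = -1) \<and> (k p = 1 \<or> k p = -1)) \<and>
    (\<Prod>p\<in>P. a p) = 1 \<and> (\<Prod>p\<in>P. b p) = 1 \<and>
    E = - (\<Sum>p\<in>P. t * (a p + b p) + site_radius t (a p) (b p) * k p) \<and>
    (\<forall>p\<in>P. \<forall>c. (A p v = c *\<^sub>R v \<longrightarrow> a p = c) \<and> (B p v = c *\<^sub>R v \<longrightarrow> b p = c))"
proof -
  obtain a w where w: "w \<noteq> 0"
    and a: "\<And>p. p \<in> P \<Longrightarrow> a p = 1 \<or> a p = -1" "\<And>p. p \<in> P \<Longrightarrow> A p w = a p *\<^sub>R w"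
    and wQ: "inherits_eigenvalues A v w"
    by (rule involution_refinement[of P A v, OF finite_P linear_ops(3) square(3) commute(3) v(1)]) (rule that)
  obtain b u where u: "u \<noteq> 0"
    and b: "\<And>p. p \<in> P \<Longrightarrow> b p = 1 \<or> b p = -1" "\<And>p. p \<in> P \<Longrightarrow> B p u = b p *\<^sub>R u"
    and uQ: "inherits_eigenvalues B w u"
    by (rule involution_refinement[of P B w, OF finite_P linear_ops(4) square(4) commute(4) w]) (rule that)
  have Aw: "A p w = c *\<^sub>R w" if "A p v = c *\<^sub>R v" for p c
    using that by (intro inherits_eigenvaluesD[OF wQ] linear_ops) (auto simp: commute)
  have Bw: "B p w = c *\<^sub>R w" if "B p v = c *\<^sub>R v" for p c
    using that by (intro inherits_eigenvaluesD[OF wQ] linear_ops) (auto simp: commute)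
  have Au: "A p u = c *\<^sub>R u" if "A p w = c *\<^sub>R w" for p c
    using that by (intro inherits_eigenvaluesD[OF uQ] linear_ops) (auto simp: commute)
  have Bu: "B p u = c *\<^sub>R u" if "B p w = c *\<^sub>R w" for p c
    using that by (intro inherits_eigenvaluesD[OF uQ] linear_ops) (auto simp: commute)
  have "Ham t w = E *\<^sub>R w" by (rule inherits_eigenvaluesD[OF wQ]) (auto simp: linear_Ham A_Ham v(2))
  then have Hu: "Ham t u = E *\<^sub>R u" by (intro inherits_eigenvaluesD[OF uQ]) (auto simp: linear_Ham B_Ham)
  let ?r = "\<lambda>p. site_radius t (a p) (b p)"
  have "\<forall>p. \<exists>cs. (fst cs)\<^sup>2 + (snd cs)\<^sup>2 = 1 \<and> 1 + (1 - t) * a p = ?r p * fst cs \<and> 1 + (1 - t) * b p = ?r p * snd cs"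
    using site_direction by simp
  then obtain cs where cs: "\<And>p. (fst (cs p))\<^sup>2 + (snd (cs p))\<^sup>2 = 1"
    "\<And>p. 1 + (1 - t) * a p = ?r p * fst (cs p)" "\<And>p. 1 + (1 - t) * b p = ?r p * snd (cs p)"
    by metis
  let ?K = "\<lambda>p. K (fst (cs p)) (snd (cs p)) p"
  \<comment> \<open>\<open>?H\<close> agrees with \<open>Ham t\<close> at \<open>u\<close>, where
    the signs are fixed. Unlike \<open>Ham t\<close> it is built from the fixed involutions
    \<open>?K p\<close> alone, so it commutes with them and its eigenvalue passes to their joint
    eigenvector.\<close>
  let ?H = "\<lambda>v. - (\<Sum>p\<in>P. (t * (a p + b p)) *\<^sub>R v + ?r p *\<^sub>R ?K p v)"
  have "Ham t u = ?H u"
    by (rule Ham_sector) (use a b Au cs in auto)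
  with Hu have HE: "?H u = E *\<^sub>R u" by simp
  have linH: "linear ?H"
    by (rule linearI)
      (simp_all add: linear_add[OF linear_K] linear_scale[OF linear_K] algebra_simps sum.distrib scaleR_right.sum)
  obtain k x where x: "x \<noteq> 0"
    and k: "\<And>p. p \<in> P \<Longrightarrow> k p = 1 \<or> k p = -1" "\<And>p. p \<in> P \<Longrightarrow> ?K p x = k p *\<^sub>R x"
    and xQ: "inherits_eigenvalues ?K u x"
    by (rule involution_refinement[of P ?K u, OF finite_P linear_K K_square[OF cs(1)] K_family_commute u]) (rule that)
  have "?H x = E *\<^sub>R x"
  proof (rule inherits_eigenvaluesD[OF xQ linH _ HE])
    fix p y
    have K_p: "?K q (?K p y) = ?K p (?K q y)" for q by (rule K_family_commute)
    show "?H (?K p y) = ?K p (?H y)"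
      unfolding neg_sum_linear[OF linear_K]
      by (simp add: linear_add[OF linear_K] linear_scale[OF linear_K] K_p)
  qed
  moreover have "?H x = (- (\<Sum>p\<in>P. t * (a p + b p) + ?r p * k p)) *\<^sub>R x"
    using k by (simp add: scaleR_left.sum scaleR_add_left scaleR_diff_left sum.distrib)
  ultimately have E: "E = - (\<Sum>p\<in>P. t * (a p + b p) + ?r p * k p)" using x by simp
  have pA: "(\<Prod>p\<in>P. a p) = 1" using prod_A[OF w] a by blast
  have pB: "(\<Prod>p\<in>P. b p) = 1" using prod_B[OF u] b by blast
  have "a p = c" if "p \<in> P" "A p v = c *\<^sub>R v" for p c
    using Aw[OF that(2)] a(2)[OF that(1)] w by simp
  moreover have "b p = c" if "p \<in> P" "B p v = c *\<^sub>R v" for p c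
    using Bu[OF Bw[OF that(2)]] b(2)[OF that(1)] u by simp
  ultimately show ?thesis using a b k E pA pB by (intro exI[of _ a] exI[of _ b] exI[of _ k]) blast
qed

section \<open>Ground energy, ground vectors and an excited state\<close>

definition E0 :: "real \<Rightarrow> real" where
  "E0 t = - (real (card P) * site_top t)"

lemma energy_as_loss:
  "- (\<Sum>p\<in>P. t * (a p + b p) + site_radius t (a p) (b p) * k p)
    = E0 t + (\<Sum>p\<in>P. site_loss t (a p) (b p) (k p))"
  by (simp add: E0_def site_loss_def sum_subtractf)

lemma energy_cases:
  assumes t: "0 \<le> t" "t \<le> 1" and v: "v \<noteq> 0" "Ham t v = E *\<^sub>R v"
  shows "E \<ge> E0 t + 4 * (sqrt 2 - 1) \<or> (E = E0 t \<and> (\<forall>p\<in>P. A p v \<noteq> - v \<and> B p v \<noteq> - v))"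
proof -
  obtain a b k where s: "\<forall>p\<in>P. (a p = 1 \<or> a p = -1) \<and> (b p = 1 \<or> b p = -1) \<and> (k p = 1 \<or> k p = -1)"
    and pr: "(\<Prod>p\<in>P. a p) = 1" "(\<Prod>p\<in>P. b p) = 1"
    and E: "E = - (\<Sum>p\<in>P. t * (a p + b p) + site_radius t (a p) (b p) * k p)"
    and AB: "\<forall>p\<in>P. \<forall>c. (A p v = c *\<^sub>R v \<longrightarrow> a p = c) \<and> (B p v = c *\<^sub>R v \<longrightarrow> b p = c)"
    using energy_decomposition[OF v] by blast
  have AB': "(A p v = - v \<longrightarrow> a p = -1) \<and> (B p v = - v \<longrightarrow> b p = -1)" if "p \<in> P" for p
    using AB[rule_format, OF that, of "-1"] by simp
  have "(\<Sum>p\<in>P. site_loss t (a p) (b p) (k p)) \<ge> 4 * (sqrt 2 - 1) \<or>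
    ((\<Sum>p\<in>P. site_loss t (a p) (b p) (k p)) = 0 \<and> (\<forall>p\<in>P. a p = 1 \<and> b p = 1 \<and> k p = 1))"
    by (rule total_loss_cases[OF t finite_P]) (use s pr in auto)
  then show ?thesis using AB' unfolding E energy_as_loss by fastforce
qed

definition stabilized :: "'v \<Rightarrow> bool" where
  "stabilized v \<longleftrightarrow> (\<forall>p\<in>P. A p v = v \<and> B p v = v \<and> K0 p v = v)"

text \<open>With \<open>a = b = 1\<close> both coefficients equal \<open>2 - t\<close>, so the
  direction is diagonal for every \<open>t\<close> and only the strength depends on
  \<open>t\<close>.\<close>

lemma Ham_code_space:
  assumes "t \<le> 1" "\<forall>p\<in>P. A p v = v \<and> B p v = v"
  shows "Ham t v = - (\<Sum>p\<in>P. (2 * t) *\<^sub>R v + ((2 - t) * sqrt 2) *\<^sub>R K0 p v)"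
  using Ham_sector[of v "\<lambda>_. 1" "\<lambda>_. 1" t "\<lambda>_. (2 - t) * sqrt 2" "\<lambda>_. 1 / sqrt 2" "\<lambda>_. 1 / sqrt 2"] assms
  by (simp add: mult.commute)

lemma Ham_stabilized:
  assumes "t \<le> 1" "stabilized v"
  shows "Ham t v = E0 t *\<^sub>R v"
  using assms Ham_code_space[of t v]
  by (simp add: stabilized_def E0_def site_top_def sum_constant_scaleR flip: scaleR_add_left)

lemma ground_imp_stabilized:
  assumes t: "0 \<le> t" "t \<le> 1" and v: "Ham t v = E0 t *\<^sub>R v"
  shows "stabilized v"
proof -
  have E: "\<not> E0 t \<ge> E0 t + 4 * (sqrt 2 - 1)" using sqrt2_bounds by simp
  \<comment> \<open>If \<open>T v\<close> differed from \<open>v\<close>, the odd part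
    \<open>v - T v\<close> would be a nonzero vector with the ground energy, reversed by
    \<open>T\<close>.\<close>
  have flip: "T v = v"
    if "linear T" "\<And>x. T (T x) = x" "\<And>x. T (Ham t x) = Ham t (T x)"
      and never: "\<And>w. w \<noteq> 0 \<Longrightarrow> Ham t w = E0 t *\<^sub>R w \<Longrightarrow> T w \<noteq> - w" for T
  proof (rule ccontr)
    assume "T v \<noteq> v"
    then have "v - T v \<noteq> 0" by simp
    moreover have "Ham t (v - T v) = E0 t *\<^sub>R (v - T v)"
      using v that(1,3) by (simp add: linear_diff[OF linear_Ham] scaleR_diff_right linear_scale flip: that(3))
    moreover have "T (v - T v) = - (v - T v)"
      using that(1,2) by (simp add: linear_diff)
    ultimately show False using never by blast
  qed
  have A: "A p v = v" if "p \<in> P" for p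
    by (rule flip) (use linear_ops square A_Ham energy_cases[OF t] E that in blast)+
  have B: "B p v = v" if "p \<in> P" for p
    by (rule flip) (use linear_ops square B_Ham energy_cases[OF t] E that in blast)+
  \<comment> \<open>The operators \<open>K0 p\<close> need not commute with \<open>Ham t\<close>, so
    the preceding argument does not cover them. On vectors fixed by all \<open>A p\<close> and
    \<open>B p\<close>, however, \<open>Ham t\<close> is an affine function of their sum
    \<open>S\<close>, and the ground energy forces the eigenvalue \<open>card P\<close> of
    \<open>S\<close>.\<close>
  define S where "S v = (\<Sum>p\<in>P. K0 p v)" for v
  define r where "r = (2 - t) * sqrt 2"
  have E0: "E0 t = - (real (card P) * (2 * t + r))" by (simp add: E0_def site_top_def r_def)
  have "E0 t *\<^sub>R v = - ((real (card P) * (2 * t)) *\<^sub>R v + r *\<^sub>R S v)"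
    using Ham_code_space[OF t(2), of v] A B v
    by (simp add: S_def r_def sum.distrib sum_constant_scaleR scaleR_right.sum)
  then have "r *\<^sub>R S v = r *\<^sub>R (real (card P) *\<^sub>R v)"
    by (simp add: E0 algebra_simps)
  then have Sv: "S v = real (card P) *\<^sub>R v" using t by (simp add: r_def del: scaleR_scaleR)
  have linS: "linear S"
    unfolding S_def by (rule linear_compose_sum) (simp add: linear_K)
  have SK: "S (K0 p x) = K0 p (S x)" for p x
    unfolding S_def by (simp add: linear_sum[OF linear_K] K0_commute[of p])
  have "K0 q v = v" if q: "q \<in> P" for q
  proof (rule ccontr)
    assume "K0 q v \<noteq> v"
    then have "v - K0 q v \<noteq> 0" by simp
    \<comment> \<open>The vector \<open>v - K0 q v\<close> is reversed by \<open>K0 q\<close> and is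
      still an eigenvector of \<open>S\<close> for \<open>card P\<close>. Its refinement would have
      signs that sum to \<open>card P\<close> although the one at \<open>q\<close> is -1.\<close>
    then obtain k x where x: "x \<noteq> 0"
      and k: "\<And>p. p \<in> P \<Longrightarrow> k p = 1 \<or> k p = (-1::real)" "\<And>p. p \<in> P \<Longrightarrow> K0 p x = k p *\<^sub>R x"
      and Q: "inherits_eigenvalues K0 (v - K0 q v) x"
      by (rule involution_refinement[of P K0 "v - K0 q v", OF finite_P linear_K K0_square K0_commute]) (rule that)
    have "S x = real (card P) *\<^sub>R x"
      using Sv SK by (intro inherits_eigenvaluesD[OF Q] linS) (auto simp: linear_diff[OF linS] linear_scale[OF linear_K] scaleR_diff_right)
    moreover have "S x = (\<Sum>p\<in>P. k p) *\<^sub>R x" using k by (simp add: S_def scaleR_left.sum)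
    ultimately have 1: "(\<Sum>p\<in>P. k p) = real (card P)" using x(1) by simp
    have "K0 q x = (-1) *\<^sub>R x"
      by (rule inherits_eigenvaluesD[OF Q]) (auto simp: linear_K linear_diff[OF linear_K] K0_square K0_commute[of _ q])
    then have "k q *\<^sub>R x = (-1) *\<^sub>R x" using k(2)[OF q] by simp
    then have "k q = -1" using x by (metis scaleR_cancel_right)
    then have "(\<Sum>p\<in>P. k p) < (\<Sum>p\<in>P. 1)"
      using k(1) q finite_P by (intro sum_strict_mono_ex1) force+
    then show False using 1 by simp
  qed
  then show ?thesis using A B by (simp add: stabilized_def)
qed

text \<open>
  Projecting \<open>e\<close> successively by the operators \<open>1 + A p\<close> and \<open>1 + K0 p\<close> could give zero; the functional
  \<open>f\<close> shows that it does not.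
\<close>
lemma stabilized_exists:
  fixes f :: "'v \<Rightarrow> 'r::real_vector"
  assumes f: "linear f" "\<And>p v. p \<in> P \<Longrightarrow> f (X p v) = f v" "\<And>p v. p \<in> P \<Longrightarrow> f (A p v) = f v"
    and e: "f e \<noteq> 0" "\<And>p. Z p e = e" "\<And>p. B p e = e"
  shows "\<exists>g. f g \<noteq> 0 \<and> stabilized g"
proof -
  have "\<exists>g. f g \<noteq> 0 \<and> (\<forall>p. Z p g = g \<and> B p g = g) \<and> (\<forall>p\<in>S. A p g = g)" if "S \<subseteq> P" for S
    using finite_subset[OF that finite_P] that
  proof (induction S)
    case (insert q S)
    from insert.IH insert.prems obtain g where g: "f g \<noteq> 0" "\<forall>p. Z p g = g \<and> B p g = g" "\<forall>p\<in>S. A p g = g" by blast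
    have "f (g + A q g) = 2 *\<^sub>R f g" using f insert.prems by (simp add: linear_add scaleR_2)
    then have "f (g + A q g) \<noteq> 0" using g(1) by simp
    moreover have "Z p (g + A q g) = g + A q g" "B p (g + A q g) = g + A q g" for p
      using g(2) by (simp_all add: linear_add_ops commute(5,7)[symmetric])
    moreover have "\<forall>p\<in>insert q S. A p (g + A q g) = g + A q g"
      using g(3) by (auto simp: linear_add_ops square commute(3)[of _ q])
    ultimately show ?case by blast
  qed (use e in blast)
  from this[OF order_refl] obtain g where g: "f g \<noteq> 0" "\<forall>p. Z p g = g \<and> B p g = g" "\<forall>p\<in>P. A p g = g"
    by blast
  \<comment> \<open>The invariant keeps \<open>Z p h = h\<close> for the labels not yet treated. At
    the next label \<open>q\<close> both \<open>X q\<close> and \<open>Z q\<close> then leave the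
    value of \<open>f\<close> unchanged, so projecting multiplies it by
    \<open>1 + sqrt 2\<close>.\<close>
  have "\<exists>h. f h \<noteq> 0 \<and> (\<forall>p\<in>P. A p h = h \<and> B p h = h) \<and> (\<forall>p\<in>S. K0 p h = h) \<and> (\<forall>p. p \<notin> S \<longrightarrow> Z p h = h)"
    if "S \<subseteq> P" for S
    using finite_subset[OF that finite_P] that
  proof (induction S)
    case (insert q S)
    from insert.IH insert.prems obtain h where h: "f h \<noteq> 0" "\<forall>p\<in>P. A p h = h \<and> B p h = h" "\<forall>p\<in>S. K0 p h = h"
      "\<forall>p. p \<notin> S \<longrightarrow> Z p h = h" by blast
    have "f (h + K0 q h) = (1 + (1 / sqrt 2 + 1 / sqrt 2)) *\<^sub>R f h"
      using f(1,2) h(4) insert.hyps insert.prems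
      by (simp only: linear_add linear_scale K_def scaleR_add_left scaleR_one) simp
    moreover have "1 + (1 / sqrt 2 + 1 / sqrt 2) > 0" by (intro add_pos_pos) simp_all
    ultimately have "f (h + K0 q h) \<noteq> 0" using h(1) by simp
    moreover have "\<forall>p\<in>P. A p (h + K0 q h) = h + K0 q h \<and> B p (h + K0 q h) = h + K0 q h"
      using h(2) by (simp add: linear_add_ops A_K B_K)
    moreover have "\<forall>p\<in>insert q S. K0 p (h + K0 q h) = h + K0 q h"
      using h(3) by (auto simp: linear_add[OF linear_K] K0_square K0_commute[of _ q])
    moreover have "Z p (h + K0 q h) = h + K0 q h" if "p \<notin> insert q S" for p
      using that h(4) commute_XZ[of q p, OF not_sym, symmetric] commute(2)[of p q]
      by (simp add: K_def linear_add_ops linear_scale_ops)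
    ultimately show ?case by blast
  qed (use g in blast)
  from this[OF order_refl] show ?thesis unfolding stabilized_def by blast
qed

text \<open>Up to a phase \<open>X p (Z p g)\<close> is Pauli Y applied to \<open>g\<close>. It
  anticommutes with \<open>X p\<close> and \<open>Z p\<close>, hence with \<open>K0 p\<close>, and
  commutes with everything else in \<open>stabilized\<close>. One sign is thus reversed, which
  lowers the sum of the \<open>K0 q\<close> by 2. This supplies the excited energy without which the
  gap is unspecified.\<close>

lemma excited_state:
  assumes "t \<le> 1" "stabilized g" "g \<noteq> 0" "p \<in> P"
  defines "v \<equiv> X p (Z p g)"
  shows "v \<noteq> 0 \<and> (\<exists>E. Ham t v = E *\<^sub>R v \<and> E \<noteq> E0 t)"
proof -
  have g: "\<forall>p\<in>P. A p g = g \<and> B p g = g \<and> K0 p g = g" using assms(2) by (simp add: stabilized_def)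
  have "v \<noteq> 0"
    using assms(3) square(1)[of p "Z p g"] square(2)[of p g] linear_0[OF linear_ops(1)] linear_0[OF linear_ops(2)]
    unfolding v_def by metis
  have AB: "\<forall>p\<in>P. A p v = v \<and> B p v = v" using g by (simp add: v_def commute)
  have "K0 p v = X p (Z p (- K0 p g))"
    by (simp add: v_def K_def linear_add_ops linear_scale_ops linear_diff_ops linear_neg_ops square anticommute_XZ)
  then have Kp: "K0 p v = - v" using g assms(4) by (simp add: v_def linear_neg_ops)
  have Kq: "K0 q v = v" if "q \<in> P" "q \<noteq> p" for q
  proof -
    have "K0 q v = X p (Z p (K0 q g))"
      using that commute_XZ[of p q] commute_XZ[of q p] commute(1)[of q p] commute(2)[of p q]
      by (simp add: v_def K_def linear_add_ops linear_scale_ops)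
    then show ?thesis using g that by (simp add: v_def)
  qed
  let ?E = "E0 t + 2 * ((2 - t) * sqrt 2)"
  have "(\<Sum>q\<in>P. K0 q v) = K0 p v + (\<Sum>q\<in>P - {p}. K0 q v)"
    using assms(4) finite_P by (rule sum.remove[rotated])
  also have "\<dots> = (real (card P) - 2) *\<^sub>R v"
  proof -
    have "real (card P) = real (card (P - {p})) + 1"
      using card.remove[OF finite_P assms(4)] by simp
    then show ?thesis
      using Kp Kq by (simp add: sum_constant_scaleR algebra_simps scaleR_2)
  qed
  finally have sum_K: "(\<Sum>q\<in>P. K0 q v) = (real (card P) - 2) *\<^sub>R v" .
  define r where "r = (2 - t) * sqrt 2"
  have "Ham t v = - ((real (card P) * (2 * t)) *\<^sub>R v + r *\<^sub>R (\<Sum>q\<in>P. K0 q v))"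
    using Ham_code_space[OF assms(1) AB]
    by (simp add: r_def sum.distrib sum_constant_scaleR scaleR_right.sum)
  then have "Ham t v = ?E *\<^sub>R v"
    unfolding sum_K E0_def site_top_def r_def[symmetric] by (simp add: algebra_simps)
  moreover have "?E \<noteq> E0 t" using assms(1) by simp
  ultimately show ?thesis using \<open>v \<noteq> 0\<close> by blast
qed

end

section \<open>Operators on amplitudes\<close>

instantiation "fun" :: (type, real_vector) real_vector
begin

definition scaleR_fun_def: "c *\<^sub>R f = (\<lambda>x. c *\<^sub>R f x)"

instance
  by standard (simp_all add: scaleR_fun_def fun_eq_iff algebra_simps)

end

lemma scaleR_fun_apply [simp]: "(c *\<^sub>R f) x = c *\<^sub>R f x"
  by (simp add: scaleR_fun_def)

lemma sum_fun_apply: "(\<Sum>p\<in>S. g p) x = (\<Sum>p\<in>S. g p x)"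
  by (induction S rule: infinite_finite_induct) simp_all

text \<open>Reindexing along the shift turns the product into the square of \<open>F g S\<close>.
  Stated for any commutative monoid, it serves both the XOR of star masks and the product of
  plaquette signs.\<close>

lemma (in comm_monoid_set) F_paired_shift:
  assumes "bij_betw s S S" "\<And>x. g x \<^bold>* g x = \<^bold>1"
  shows "F (\<lambda>x. g x \<^bold>* g (s x)) S = \<^bold>1"
proof -
  have "F (\<lambda>x. g x \<^bold>* g (s x)) S = F g S \<^bold>* F g S"
    by (simp add: distrib reindex_bij_betw[OF assms(1), of g])
  also have "\<dots> = F (\<lambda>x. g x \<^bold>* g x) S" by (rule distrib[symmetric])
  finally show ?thesis using assms(2) by simp
qed

unbundle bit_operations_syntax

interpretation xor_sum: comm_monoid_set "(XOR) :: nat \<Rightarrow> nat \<Rightarrow> nat" 0 ..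

lemma xor_lt_exp:
  fixes i m :: nat assumes "i < 2 ^ n" "m < 2 ^ n" shows "i XOR m < 2 ^ n"
  using assms by (simp flip: take_bit_nat_eq_self_iff)

text \<open>
  A state is given by its amplitudes on all of \<open>nat\<close>, so that Pauli strings act without bounds on the
  indices; those of a register are supported below its dimension.
\<close>
type_synonym amplitudes = "nat \<Rightarrow> complex"

text \<open>This is the product of the Pauli X over the qubits whose bits are set in
  \<open>m\<close>; composition becomes XOR of masks.\<close>

definition xmask :: "nat \<Rightarrow> amplitudes \<Rightarrow> amplitudes" where
  "xmask m f = (\<lambda>i. f (i XOR m))"

definition zmul :: "(nat \<Rightarrow> real) \<Rightarrow> amplitudes \<Rightarrow> amplitudes" where
  "zmul s f = (\<lambda>i. s i *\<^sub>R f i)"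

definition bit_sign :: "nat \<Rightarrow> nat \<Rightarrow> real" where
  "bit_sign k i = (if bit i k then -1 else 1)"

lemma linear_xmask: "linear (xmask m)" and linear_zmul: "linear (zmul s)"
  by (rule linearI; simp add: xmask_def zmul_def fun_eq_iff algebra_simps)+

lemma xmask_xmask: "xmask m (xmask m' f) = xmask (m XOR m') f"
  by (simp add: xmask_def fun_eq_iff ac_simps)

lemma xmask_zmul: "xmask m (zmul s f) = zmul (\<lambda>i. s (i XOR m)) (xmask m f)"
  by (simp add: xmask_def zmul_def)

lemma bit_sign_square: "bit_sign k i * bit_sign k i = 1"
  by (simp add: bit_sign_def)

lemma bit_sign_xor: "bit_sign k (i XOR m) = bit_sign k i * bit_sign k m"
  by (simp add: bit_sign_def bit_xor_iff)

lemma bit_sign_exp: "bit_sign k (2 ^ j) = (if j = k then -1 else 1)"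
  by (simp add: bit_sign_def bit_exp_iff)

section \<open>Matrices represented by operators on amplitudes\<close>

text \<open>A matrix sees only the indices below \<open>N\<close>. The last clause makes an
  eigenvalue equation for the matrix hold for the padded amplitudes at all indices.\<close>

definition represents :: "nat \<Rightarrow> complex mat \<Rightarrow> (amplitudes \<Rightarrow> amplitudes) \<Rightarrow> bool" where
  "represents N M T \<longleftrightarrow> M \<in> carrier_mat N N \<and> (\<forall>f. M *\<^sub>v vec N f = vec N (T f)) \<and>
     (\<forall>f. (\<forall>i\<ge>N. f i = 0) \<longrightarrow> (\<forall>i\<ge>N. T f i = 0))"

lemma representsI:
  assumes "M \<in> carrier_mat N N" "\<And>f i. i < N \<Longrightarrow> (\<Sum>j<N. M $$ (i, j) * f j) = T f i"
    "\<And>f i. (\<forall>i\<ge>N. f i = 0) \<Longrightarrow> i \<ge> N \<Longrightarrow> T f i = 0"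
  shows "represents N M T"
  using assms unfolding represents_def by (auto simp: scalar_prod_def atLeast0LessThan)

lemma representsD:
  assumes "represents N M T"
  shows "M \<in> carrier_mat N N" "M *\<^sub>v vec N f = vec N (T f)"
    "\<And>f i. (\<forall>i\<ge>N. f i = 0) \<Longrightarrow> i \<ge> N \<Longrightarrow> T f i = 0"
  using assms by (auto simp: represents_def)

lemma represents_row:
  assumes "represents N M T" "i < N"
  shows "(\<Sum>j<N. M $$ (i, j) * f j) = T f i"
proof -
  have "(M *\<^sub>v vec N f) $ i = T f i" using representsD(2)[OF assms(1)] assms(2) by simp
  then show ?thesis using representsD(1)[OF assms(1)] assms(2)
    by (simp add: scalar_prod_def atLeast0LessThan)
qed

lemma represents_mult:
  assumes "represents N M T" "represents N M' T'"
  shows "represents N (M * M') (\<lambda>f. T (T' f))"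
  using assms unfolding represents_def by (auto simp: assoc_mult_mat_vec[of _ N N _ N])

lemma represents_add:
  assumes "represents N M T" "represents N M' T'"
  shows "represents N (M + M') (\<lambda>f. T f + T' f)"
  by (rule representsI)
    (use representsD[OF assms(1)] representsD[OF assms(2)] represents_row[OF assms(1)] represents_row[OF assms(2)]
      in \<open>auto simp: distrib_right sum.distrib\<close>)

lemma represents_uminus:
  assumes "represents N M T"
  shows "represents N (- M) (\<lambda>f. - T f)"
  by (rule representsI)
    (use representsD[OF assms] represents_row[OF assms] in \<open>auto simp: sum_negf\<close>)

lemma represents_smult:
  assumes "represents N M T"
  shows "represents N (complex_of_real c \<cdot>\<^sub>m M) (\<lambda>f. c *\<^sub>R T f)"
  by (rule representsI)
    (use representsD[OF assms] represents_row[OF assms]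
      in \<open>auto simp: mult.assoc scaleR_conv_of_real simp flip: sum_distrib_left\<close>)

lemma represents_mat_sum:
  assumes "\<And>p. p \<in> I \<Longrightarrow> represents N (M p) (T p)"
  shows "represents N (mat_sum N M I) (\<lambda>f. \<Sum>p\<in>I. T p f)"
proof (rule representsI)
  show "(\<Sum>j<N. mat_sum N M I $$ (i, j) * f j) = (\<Sum>p\<in>I. T p f) i" if "i < N" for f i
  proof -
    have "(\<Sum>j<N. mat_sum N M I $$ (i, j) * f j) = (\<Sum>j<N. \<Sum>p\<in>I. M p $$ (i, j) * f j)"
      using that by (simp add: mat_sum_def sum_distrib_right)
    also have "\<dots> = (\<Sum>p\<in>I. \<Sum>j<N. M p $$ (i, j) * f j)" by (rule sum.swap)
    finally show ?thesis using represents_row[OF assms that] by (simp add: sum_fun_apply)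
  qed
  show "(\<Sum>p\<in>I. T p f) i = 0" if "\<forall>i\<ge>N. f i = 0" "i \<ge> N" for f i
    using representsD(3)[OF assms that] by (simp add: sum_fun_apply)
qed (simp add: mat_sum_def)

lemma bits_agree_off:
  fixes i j :: nat
  assumes "i < 2 ^ n" "j < 2 ^ n" "k < n" "\<forall>m<n. m \<noteq> k \<longrightarrow> bit i m = bit j m"
  shows "j = (if bit i k = bit j k then i else i XOR 2 ^ k)"
proof (rule bit_eqI)
  have hi: "\<not> bit i m" "\<not> bit j m" if "m \<ge> n" for m
    using that assms(1,2) by (metis bit_take_bit_iff take_bit_nat_eq_self_iff leD)+
  fix m
  show "bit j m = bit (if bit i k = bit j k then i else i XOR 2 ^ k) m"
    using assms(3,4) hi[of m] by (cases "m < n"; cases "m = k") (auto simp: bit_xor_iff bit_exp_iff)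
qed

lemma on_qubit_X_entry:
  assumes "i < 2 ^ n" "j < 2 ^ n" "k < n"
  shows "on_qubit n pauli_X k $$ (i, j) = (if j = i XOR 2 ^ k then 1 else 0)"
proof -
  have X: "pauli_X $$ (of_bool a, of_bool b) = (if a \<noteq> b then 1 else 0)" for a b
    by (cases a; cases b) (simp_all add: pauli_X_def mat_of_rows_list_def)
  have "i XOR 2 ^ k \<noteq> i" using bit_exp_iff[of k k, where ?'a = nat] by (metis bit_xor_iff possible_bit_nat)
  then show ?thesis
    using bits_agree_off[OF assms] assms
    by (auto simp: on_qubit_def X bit_xor_iff bit_exp_iff)
qed

lemma on_qubit_Z_entry:
  assumes "i < 2 ^ n" "j < 2 ^ n" "k < n"
  shows "on_qubit n pauli_Z k $$ (i, j) = (if j = i then of_real (bit_sign k i) else 0)"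
proof -
  have Z: "pauli_Z $$ (of_bool a, of_bool b) = (if a = b then if a then -1 else 1 else 0)" for a b
    by (cases a; cases b) (simp_all add: pauli_Z_def mat_of_rows_list_def)
  then show ?thesis
    using bits_agree_off[OF assms] assms
    by (auto simp: on_qubit_def Z bit_sign_def)
qed

lemma represents_X:
  assumes "k < n"
  shows "represents (2 ^ n) (on_qubit n pauli_X k) (xmask (2 ^ k))"
proof (rule representsI)
  have k: "(2::nat) ^ k < 2 ^ n" using assms by simp
  show "(\<Sum>j<2 ^ n. on_qubit n pauli_X k $$ (i, j) * f j) = xmask (2 ^ k) f i" if "i < 2 ^ n" for f i
    using that assms xor_lt_exp[OF that k]
    by (simp add: on_qubit_X_entry xmask_def if_distrib[of "\<lambda>x. x * _"] cong: if_cong)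
  show "xmask (2 ^ k) f i = 0" if "\<forall>i\<ge>2 ^ n. f i = 0" "i \<ge> 2 ^ n" for f i
  proof -
    have "\<not> i XOR 2 ^ k < 2 ^ n"
      using xor_lt_exp[OF _ k, of "i XOR 2 ^ k"] that(2) by (auto simp: xor.assoc)
    then show ?thesis using that(1) by (simp add: xmask_def)
  qed
qed (simp add: on_qubit_def)

lemma represents_Z:
  assumes "k < n"
  shows "represents (2 ^ n) (on_qubit n pauli_Z k) (zmul (bit_sign k))"
proof (rule representsI)
  show "(\<Sum>j<2 ^ n. on_qubit n pauli_Z k $$ (i, j) * f j) = zmul (bit_sign k) f i" if "i < 2 ^ n" for f i
    using that assms
    by (simp add: on_qubit_Z_entry zmul_def scaleR_conv_of_real if_distrib[of "\<lambda>x. x * _"] cong: if_cong)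
qed (simp_all add: on_qubit_def zmul_def)

definition extend0 :: "nat \<Rightarrow> complex vec \<Rightarrow> amplitudes" where
  "extend0 N v = (\<lambda>i. if i < N then v $ i else 0)"

lemma vec_extend0: "v \<in> carrier_vec N \<Longrightarrow> vec N (extend0 N v) = v"
  by (auto simp: extend0_def)

lemma extend0_eq_0_iff: "v \<in> carrier_vec N \<Longrightarrow> extend0 N v = 0 \<longleftrightarrow> v = 0\<^sub>v N"
  by (auto simp: extend0_def fun_eq_iff)

lemma represents_eigen_iff:
  assumes "represents N M T" "v \<in> carrier_vec N"
  shows "M *\<^sub>v v = complex_of_real c \<cdot>\<^sub>v v \<longleftrightarrow> T (extend0 N v) = c *\<^sub>R extend0 N v"
proof -
  let ?f = "extend0 N v"
  have "M *\<^sub>v v = vec N (T ?f)" using representsD(2)[OF assms(1), of ?f] vec_extend0[OF assms(2)] by simp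
  moreover have "T ?f i = 0" if "i \<ge> N" for i
    using representsD(3)[OF assms(1), of ?f i] that by (simp add: extend0_def)
  ultimately show ?thesis using assms(2)
    by (auto simp: fun_eq_iff extend0_def scaleR_conv_of_real vec_eq_iff)
qed

lemma energies_iff:
  assumes "represents N M T"
  shows "E \<in> energies M \<longleftrightarrow> (\<exists>v\<in>carrier_vec N. v \<noteq> 0\<^sub>v N \<and> T (extend0 N v) = E *\<^sub>R extend0 N v)"
proof -
  have "dim_row M = N" using representsD(1)[OF assms] by simp
  then show ?thesis
    unfolding energies_def spectrum_def eigenvalue_def eigenvector_def
    using represents_eigen_iff[OF assms] by auto
qed

lemma finite_energies:
  assumes "M \<in> carrier_mat N N" shows "finite (energies M)"
proof -
  have "complex_of_real ` energies M \<subseteq> spectrum M" by (auto simp: energies_def)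
  then show ?thesis
    using card_finite_spectrum(1)[OF assms] by (meson finite_imageD finite_subset inj_of_real inj_on_subset subset_UNIV)
qed

definition basis_amp :: "nat \<Rightarrow> amplitudes" where
  "basis_amp j = (\<lambda>i. if i = j then 1 else 0)"

lemma represents_entry:
  assumes "represents N M T" "i < N" "j < N"
  shows "M $$ (i, j) = T (basis_amp j) i"
  using represents_row[OF assms(1,2), of "basis_amp j"] assms(3)
  by (simp add: basis_amp_def if_distrib[of "\<lambda>x. _ * x"] cong: if_cong)

lemma represents_self_adjoint:
  assumes "represents N M T" "\<And>i j. T (basis_amp j) i = cnj (T (basis_amp i) j)"
  shows "self_adjoint M"
proof -
  have M: "M \<in> carrier_mat N N" using representsD(1)[OF assms(1)] .
  have "mat_adjoint M = M"
  proof (rule eq_matI)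
    fix i j assume "i < dim_row M" "j < dim_col M"
    then have ij: "i < N" "j < N" using M by auto
    then have "mat_adjoint M $$ (i, j) = cnj (M $$ (j, i))"
      using M by (simp add: mat_adjoint_def mat_of_rows_index)
    also have "\<dots> = M $$ (i, j)"
      using represents_entry[OF assms(1)] assms(2) ij by metis
    finally show "mat_adjoint M $$ (i, j) = M $$ (i, j)" .
  qed (use M in \<open>auto simp: mat_adjoint_def\<close>)
  then show ?thesis using M by (simp add: self_adjoint_def)
qed

section \<open>The toric code\<close>

lemma hor_edge_eq_iff:
  assumes "L > 0"
  shows "hor_edge L x y = hor_edge L u w \<longleftrightarrow> x mod L = u mod L \<and> y mod L = w mod L"
proof
  assume eq: "hor_edge L x y = hor_edge L u w"
  have "hor_edge L x y mod L = x mod L" "hor_edge L x y div L = y mod L" for x y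
    using assms by (simp_all add: hor_edge_def)
  then show "x mod L = u mod L \<and> y mod L = w mod L" using eq by metis
qed (simp add: hor_edge_def)

lemma ver_edge_hor_edge: "ver_edge L x y = L\<^sup>2 + hor_edge L x y"
  by (simp add: ver_edge_def hor_edge_def)

lemma ver_edge_eq_iff:
  assumes "L > 0"
  shows "ver_edge L x y = ver_edge L u w \<longleftrightarrow> x mod L = u mod L \<and> y mod L = w mod L"
  using hor_edge_eq_iff[OF assms] by (simp add: ver_edge_hor_edge)

lemma hor_edge_less:
  assumes "L > 0" shows "hor_edge L x y < L\<^sup>2"
proof -
  have "L * (y mod L) \<le> L * (L - 1)" using assms by (intro mult_left_mono) (simp_all add: less_Suc_eq_le[symmetric])
  moreover have "x mod L < L" using assms by simp
  moreover have "L + L * (L - 1) = L\<^sup>2" using assms by (cases L) (simp_all add: power2_eq_square)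
  ultimately show ?thesis unfolding hor_edge_def by linarith
qed

lemma hor_edge_neq_ver_edge:
  assumes "L > 0" shows "hor_edge L x y \<noteq> ver_edge L u w"
  using hor_edge_less[OF assms, of x y] by (simp add: ver_edge_hor_edge)

lemma edge_less:
  assumes "L > 0"
  shows "hor_edge L x y < 2 * L\<^sup>2" "ver_edge L x y < 2 * L\<^sup>2"
  using hor_edge_less[OF assms, of x y] by (simp_all add: ver_edge_hor_edge)

lemma mod_pred_eq_iff:
  fixes x u L :: nat
  assumes "L > 0" shows "(x + L - 1) mod L = u mod L \<longleftrightarrow> x mod L = (u + 1) mod L"
proof
  assume "(x + L - 1) mod L = u mod L"
  then have "(x + L - 1 + 1) mod L = (u + 1) mod L" by (rule mod_add_cong) simp
  then show "x mod L = (u + 1) mod L" using assms by simp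
next
  assume "x mod L = (u + 1) mod L"
  then have "(x + (L - 1)) mod L = (u + 1 + (L - 1)) mod L" by (rule mod_add_cong) simp
  then show "(x + L - 1) mod L = u mod L" using assms by simp
qed

section \<open>Stars as bit masks and plaquettes as signs\<close>

definition star_mask :: "nat \<Rightarrow> nat \<times> nat \<Rightarrow> nat" where
  "star_mask L = (\<lambda>(x, y). (2 ^ hor_edge L x y XOR 2 ^ hor_edge L (x + L - 1) y) XOR
     (2 ^ ver_edge L x y XOR 2 ^ ver_edge L x (y + L - 1)))"

definition plaquette_sign :: "nat \<Rightarrow> nat \<times> nat \<Rightarrow> nat \<Rightarrow> real" where
  "plaquette_sign L = (\<lambda>(u, w) i. (bit_sign (hor_edge L u w) i * bit_sign (hor_edge L u (w + 1)) i) *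
     (bit_sign (ver_edge L u w) i * bit_sign (ver_edge L (u + 1) w) i))"

lemma plaquette_sign_xor: "plaquette_sign L f (i XOR m) = plaquette_sign L f i * plaquette_sign L f m"
  by (simp add: plaquette_sign_def bit_sign_xor split: prod.split)

lemma plaquette_sign_square: "plaquette_sign L f i * plaquette_sign L f i = 1"
  by (simp add: plaquette_sign_def bit_sign_def split: prod.split)

text \<open>A star and a plaquette share an even number of edges. Each of the four coincidences of a
  coordinate pair, such as \<open>a \<and> b\<close>, contributes its sign once through a horizontal
  and once through a vertical edge. Coinciding edges are counted with multiplicity, so small
  \<open>L\<close> is covered too.\<close>

lemma plaquette_sign_star_mask:
  assumes "L > 0" shows "plaquette_sign L f (star_mask L v) = 1"
proof -
  obtain x y u w where [simp]: "v = (x, y)" "f = (u, w)" by (cases v; cases f)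
  define a a' b b' where "a \<longleftrightarrow> x mod L = u mod L" and "a' \<longleftrightarrow> x mod L = (u + 1) mod L"
    and "b \<longleftrightarrow> y mod L = w mod L" and "b' \<longleftrightarrow> y mod L = (w + 1) mod L"
  have *: "bit_sign (hor_edge L u w) (star_mask L v) = (if a \<and> b then -1 else 1) * (if a' \<and> b then -1 else 1)"
     "bit_sign (hor_edge L u (w + 1)) (star_mask L v) = (if a \<and> b' then -1 else 1) * (if a' \<and> b' then -1 else 1)"
     "bit_sign (ver_edge L u w) (star_mask L v) = (if a \<and> b then -1 else 1) * (if a \<and> b' then -1 else 1)"
     "bit_sign (ver_edge L (u + 1) w) (star_mask L v) = (if a' \<and> b then -1 else 1) * (if a' \<and> b' then -1 else 1)"
    by (simp_all only: \<open>v = (x, y)\<close> star_mask_def bit_sign_xor bit_sign_exp prod.case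
        hor_edge_eq_iff[OF assms] ver_edge_eq_iff[OF assms] mod_pred_eq_iff[OF assms]
        hor_edge_neq_ver_edge[OF assms] hor_edge_neq_ver_edge[OF assms, symmetric]
        a_def[symmetric] a'_def[symmetric] b_def[symmetric] b'_def[symmetric] if_False mult_1_left mult_1_right)
  show ?thesis
    by (simp only: plaquette_sign_def \<open>f = (u, w)\<close> prod.case *)
      (cases a; cases a'; cases b; cases b'; simp)
qed

lemma plaquette_sign_exp:
  assumes "L > 0" "k \<ge> 2 * L\<^sup>2" shows "plaquette_sign L f (2 ^ k) = 1"
proof -
  have "k \<noteq> hor_edge L x y" "k \<noteq> ver_edge L x y" for x y
    using edge_less[OF assms(1), of x y] assms(2) by auto
  then show ?thesis by (simp add: plaquette_sign_def bit_sign_exp split: prod.split)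
qed

lemma bit_sign_star_mask:
  assumes "L > 0" "k \<ge> 2 * L\<^sup>2" shows "bit_sign k (star_mask L v) = 1"
proof -
  have "hor_edge L x y \<noteq> k" "ver_edge L x y \<noteq> k" for x y
    using edge_less[OF assms(1), of x y] assms(2) by auto
  then show ?thesis by (simp add: star_mask_def bit_sign_exp bit_sign_xor split: prod.split)
qed

section \<open>Products over the whole torus\<close>

lemma torus_succ_pred:
  fixes x L :: nat
  assumes "x < L"
  shows "((x + 1) mod L + L - 1) mod L = x" "((x + L - 1) mod L + 1) mod L = x"
proof -
  have L: "L > 0" using assms by simp
  show "((x + 1) mod L + L - 1) mod L = x"
    using mod_pred_eq_iff[OF L, of "(x + 1) mod L" x] assms by simp
  show "((x + L - 1) mod L + 1) mod L = x"
    using mod_pred_eq_iff[OF L, of x "(x + L - 1) mod L"] assms by simp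
qed

lemma bij_betw_torus_succ:
  fixes L :: nat assumes "L > 0" shows "bij_betw (\<lambda>x. (x + 1) mod L) {..<L} {..<L}"
  by (rule bij_betwI[where g="\<lambda>x. (x + L - 1) mod L"]; use assms torus_succ_pred in force)

lemma bij_betw_torus_pred:
  fixes L :: nat assumes "L > 0" shows "bij_betw (\<lambda>x. (x + L - 1) mod L) {..<L} {..<L}"
  by (rule bij_betwI[where g="\<lambda>x. (x + 1) mod L"]; use assms torus_succ_pred in force)

text \<open>Every edge belongs to the stars of its two end points and so cancels. Sorted by
  orientation, a star consists of two pairs, each an edge and its translate by one step.\<close>

lemma xor_sum_star_mask:
  assumes "L > 0"
  shows "xor_sum.F (star_mask L) ({..<L} \<times> {..<L}) = 0"
proof -
  let ?S = "{..<L} \<times> {..<L}" and ?pred = "\<lambda>x. (x + L - 1) mod L"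
  let ?h = "\<lambda>(x, y). (2::nat) ^ hor_edge L x y" and ?v = "\<lambda>(x, y). (2::nat) ^ ver_edge L x y"
  have "xor_sum.F (star_mask L) ?S
    = xor_sum.F (\<lambda>p. (?h p XOR ?h (map_prod ?pred id p)) XOR (?v p XOR ?v (map_prod id ?pred p))) ?S"
    by (rule xor_sum.cong) (auto simp: star_mask_def hor_edge_def ver_edge_def)
  also have "\<dots> = xor_sum.F (\<lambda>p. ?h p XOR ?h (map_prod ?pred id p)) ?S
      XOR xor_sum.F (\<lambda>p. ?v p XOR ?v (map_prod id ?pred p)) ?S"
    by (rule xor_sum.distrib)
  also have "\<dots> = 0"
    using xor_sum.F_paired_shift[OF bij_betw_map_prod[OF bij_betw_torus_pred[OF assms] bij_betw_id], of ?h]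
      xor_sum.F_paired_shift[OF bij_betw_map_prod[OF bij_betw_id bij_betw_torus_pred[OF assms]], of ?v]
    by (simp add: split_beta)
  finally show ?thesis .
qed

text \<open>Dually, every edge borders two faces, and its sign is squared in the product.\<close>

lemma prod_plaquette_sign:
  assumes "L > 0"
  shows "(\<Prod>f\<in>{..<L} \<times> {..<L}. plaquette_sign L f i) = 1"
proof -
  let ?S = "{..<L} \<times> {..<L}" and ?succ = "\<lambda>x. (x + 1) mod L"
  let ?h = "\<lambda>(x, y). bit_sign (hor_edge L x y) i" and ?v = "\<lambda>(x, y). bit_sign (ver_edge L x y) i"
  have "(\<Prod>f\<in>?S. plaquette_sign L f i)
    = (\<Prod>p\<in>?S. (?h p * ?h (map_prod id ?succ p)) * (?v p * ?v (map_prod ?succ id p)))"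
    by (rule prod.cong) (auto simp: plaquette_sign_def hor_edge_def ver_edge_def)
  also have "\<dots> = (\<Prod>p\<in>?S. ?h p * ?h (map_prod id ?succ p)) * (\<Prod>p\<in>?S. ?v p * ?v (map_prod ?succ id p))"
    by (rule prod.distrib)
  also have "\<dots> = 1"
    using prod.F_paired_shift[OF bij_betw_map_prod[OF bij_betw_id bij_betw_torus_succ[OF assms]], of ?h]
      prod.F_paired_shift[OF bij_betw_map_prod[OF bij_betw_torus_succ[OF assms] bij_betw_id], of ?v]
    by (simp add: split_beta bit_sign_square)
  finally show ?thesis .
qed

lemma xmask_joint_eigenvector:
  assumes "finite S" "\<And>p. p \<in> S \<Longrightarrow> xmask (m p) v = a p *\<^sub>R v"
  shows "xmask (xor_sum.F m S) v = (\<Prod>p\<in>S. a p) *\<^sub>R v"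
  using assms
proof (induction S)
  case empty
  then show ?case by (simp add: xmask_def)
next
  case (insert q S)
  have "xmask (xor_sum.F m (insert q S)) v = xmask (m q) (xmask (xor_sum.F m S) v)"
    using insert.hyps by (simp add: xmask_xmask)
  also have "\<dots> = xmask (m q) ((\<Prod>p\<in>S. a p) *\<^sub>R v)"
    using insert.IH[OF insert.prems[OF insertI2]] by (simp only:)
  also have "\<dots> = (\<Prod>p\<in>S. a p) *\<^sub>R a q *\<^sub>R v"
    using insert.prems by (simp only: linear_scale[OF linear_xmask] insertI1)
  also have "\<dots> = (\<Prod>p\<in>insert q S. a p) *\<^sub>R v" using insert.hyps by (simp add: mult.commute)
  finally show ?case .
qed

lemma toric_stabilizer_hamiltonian:
  assumes L: "L > 0"
    and vtx: "bij_betw vtx {..<L\<^sup>2} ({..<L} \<times> {..<L})"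
    and face: "bij_betw face {..<L\<^sup>2} ({..<L} \<times> {..<L})"
  shows "stabilizer_hamiltonian {..<L\<^sup>2} (\<lambda>p. xmask (2 ^ ancilla L p)) (\<lambda>p. zmul (bit_sign (ancilla L p)))
    (\<lambda>p. xmask (star_mask L (vtx p))) (\<lambda>p. zmul (plaquette_sign L (face p)))"
proof (rule stabilizer_hamiltonian.intro)
  have anc: "2 * L\<^sup>2 \<le> ancilla L p" for p by (simp add: ancilla_def)
  have anc_inj: "ancilla L p = ancilla L q \<longleftrightarrow> p = q" for p q by (simp add: ancilla_def)
  fix p q :: nat and v :: amplitudes
  show "linear (xmask (2 ^ ancilla L p))" "linear (xmask (star_mask L (vtx p)))" by (rule linear_xmask)+
  show "linear (zmul (bit_sign (ancilla L p)))" "linear (zmul (plaquette_sign L (face p)))" by (rule linear_zmul)+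
  show "xmask (2 ^ ancilla L p) (xmask (2 ^ ancilla L p) v) = v"
    "xmask (star_mask L (vtx p)) (xmask (star_mask L (vtx p)) v) = v"
    by (simp_all add: xmask_xmask) (simp_all add: xmask_def)
  show "zmul (bit_sign (ancilla L p)) (zmul (bit_sign (ancilla L p)) v) = v"
    "zmul (plaquette_sign L (face p)) (zmul (plaquette_sign L (face p)) v) = v"
    by (simp_all add: zmul_def bit_sign_square plaquette_sign_square)
  show "xmask (2 ^ ancilla L p) (xmask (2 ^ ancilla L q) v) = xmask (2 ^ ancilla L q) (xmask (2 ^ ancilla L p) v)"
    "xmask (star_mask L (vtx p)) (xmask (star_mask L (vtx q)) v) = xmask (star_mask L (vtx q)) (xmask (star_mask L (vtx p)) v)"
    "xmask (star_mask L (vtx p)) (xmask (2 ^ ancilla L q) v) = xmask (2 ^ ancilla L q) (xmask (star_mask L (vtx p)) v)"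
    by (simp_all add: xmask_xmask ac_simps)
  show "zmul (bit_sign (ancilla L p)) (zmul (bit_sign (ancilla L q)) v)
      = zmul (bit_sign (ancilla L q)) (zmul (bit_sign (ancilla L p)) v)"
    "zmul (plaquette_sign L (face p)) (zmul (plaquette_sign L (face q)) v)
      = zmul (plaquette_sign L (face q)) (zmul (plaquette_sign L (face p)) v)"
    "zmul (plaquette_sign L (face p)) (zmul (bit_sign (ancilla L q)) v)
      = zmul (bit_sign (ancilla L q)) (zmul (plaquette_sign L (face p)) v)"
    by (simp_all add: zmul_def mult.commute)
  show "xmask (star_mask L (vtx p)) (zmul (plaquette_sign L (face q)) v)
      = zmul (plaquette_sign L (face q)) (xmask (star_mask L (vtx p)) v)"
    by (simp add: xmask_zmul plaquette_sign_xor plaquette_sign_star_mask[OF L])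
  show "xmask (star_mask L (vtx p)) (zmul (bit_sign (ancilla L q)) v)
      = zmul (bit_sign (ancilla L q)) (xmask (star_mask L (vtx p)) v)"
    by (simp add: xmask_zmul bit_sign_xor bit_sign_star_mask[OF L anc])
  show "zmul (plaquette_sign L (face p)) (xmask (2 ^ ancilla L q) v)
      = xmask (2 ^ ancilla L q) (zmul (plaquette_sign L (face p)) v)"
    by (simp add: xmask_zmul plaquette_sign_xor plaquette_sign_exp[OF L anc])
  show "xmask (2 ^ ancilla L p) (zmul (bit_sign (ancilla L q)) v)
      = zmul (bit_sign (ancilla L q)) (xmask (2 ^ ancilla L p) v)" if "p \<noteq> q"
    using that by (simp add: xmask_zmul bit_sign_xor bit_sign_exp anc_inj)
  show "xmask (2 ^ ancilla L p) (zmul (bit_sign (ancilla L p)) v)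
      = - zmul (bit_sign (ancilla L p)) (xmask (2 ^ ancilla L p) v)"
    by (simp add: xmask_zmul bit_sign_xor bit_sign_exp xmask_def zmul_def fun_eq_iff)
next
  fix v :: amplitudes and a :: "nat \<Rightarrow> real"
  assume v: "v \<noteq> 0" and eig: "\<And>p. p \<in> {..<L\<^sup>2} \<Longrightarrow> xmask (star_mask L (vtx p)) v = a p *\<^sub>R v"
  have "xor_sum.F (\<lambda>p. star_mask L (vtx p)) {..<L\<^sup>2} = 0"
    using xor_sum.reindex_bij_betw[OF vtx, of "star_mask L"] xor_sum_star_mask[OF L] by simp
  then have "(\<Prod>p<L\<^sup>2. a p) *\<^sub>R v = xmask 0 v"
    using xmask_joint_eigenvector[of "{..<L\<^sup>2}" "\<lambda>p. star_mask L (vtx p)" v a, OF _ eig] by simp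
  also have "\<dots> = 1 *\<^sub>R v" by (simp add: xmask_def)
  finally show "(\<Prod>p<L\<^sup>2. a p) = 1" using v by (metis scaleR_cancel_right)
next
  fix v :: amplitudes and b :: "nat \<Rightarrow> real"
  assume "v \<noteq> 0" and eig: "\<And>p. p \<in> {..<L\<^sup>2} \<Longrightarrow> zmul (plaquette_sign L (face p)) v = b p *\<^sub>R v"
  \<comment> \<open>For diagonal operators, a joint eigenvalue is the sign at any index where
    \<open>v\<close> does not vanish, so the relation among signs can be read off there.\<close>
  then obtain i where i: "v i \<noteq> 0" by (auto simp: fun_eq_iff)
  have "plaquette_sign L (face p) i = b p" if "p \<in> {..<L\<^sup>2}" for p
    using fun_cong[OF eig[OF that], of i] i by (simp add: zmul_def)
  then have "(\<Prod>p<L\<^sup>2. b p) = (\<Prod>p<L\<^sup>2. plaquette_sign L (face p) i)"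
    by (intro prod.cong) simp_all
  also have "\<dots> = 1"
    using prod.reindex_bij_betw[OF face, of "\<lambda>f. plaquette_sign L f i"] prod_plaquette_sign[OF L] by simp
  finally show "(\<Prod>p<L\<^sup>2. b p) = 1" .
qed simp

section \<open>From the matrices to the abstract Hamiltonian\<close>

lemma represents_star_op:
  assumes "L > 0"
  shows "represents (hilbert_dim L) (star_op L v) (xmask (star_mask L v))"
proof -
  have "hor_edge L x y < num_qubits L" "ver_edge L x y < num_qubits L" for x y
    using edge_less[OF assms, of x y] by (auto simp: num_qubits_def)
  note X = this[THEN represents_X]
  obtain x y where v: "v = (x, y)" by (cases v)
  show ?thesis
    using represents_mult[OF represents_mult[OF represents_mult[OF X(1)[of x y] X(1)[of "x + L - 1" y]]
        X(2)[of x y]] X(2)[of x "y + L - 1"]]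
    by (simp add: v star_op_def star_mask_def hilbert_dim_def xmask_xmask xor.assoc)
qed

lemma represents_plaquette_op:
  assumes "L > 0"
  shows "represents (hilbert_dim L) (plaquette_op L f) (zmul (plaquette_sign L f))"
proof -
  have "hor_edge L x y < num_qubits L" "ver_edge L x y < num_qubits L" for x y
    using edge_less[OF assms, of x y] by (auto simp: num_qubits_def)
  note Z = this[THEN represents_Z]
  obtain x y where f: "f = (x, y)" by (cases f)
  have "zmul (plaquette_sign L f) = (\<lambda>g. zmul (bit_sign (hor_edge L x y)) (zmul (bit_sign (hor_edge L x (y + 1)))
      (zmul (bit_sign (ver_edge L x y)) (zmul (bit_sign (ver_edge L (x + 1) y)) g))))"
    by (simp add: f plaquette_sign_def zmul_def fun_eq_iff mult.assoc)
  then show ?thesis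
    using represents_mult[OF represents_mult[OF represents_mult[OF Z(1)[of x y] Z(1)[of x "y + 1"]]
        Z(2)[of x y]] Z(2)[of "x + 1" y]]
    by (simp only: f plaquette_op_def hilbert_dim_def prod.case)
qed

lemma represents_JX: "p < L\<^sup>2 \<Longrightarrow> represents (hilbert_dim L) (JX L p) (xmask (2 ^ ancilla L p))"
  and represents_JZ: "p < L\<^sup>2 \<Longrightarrow> represents (hilbert_dim L) (JZ L p) (zmul (bit_sign (ancilla L p)))"
  by (auto simp: JX_def JZ_def hilbert_dim_def num_qubits_def ancilla_def intro!: represents_X represents_Z)

locale toric_code =
  fixes L :: nat and vtx face :: "nat \<Rightarrow> nat \<times> nat"
  assumes L_pos: "L > 0"
    and vtx: "bij_betw vtx {..<L\<^sup>2} ({..<L} \<times> {..<L})"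
    and face: "bij_betw face {..<L\<^sup>2} ({..<L} \<times> {..<L})"
begin

abbreviation "N \<equiv> hilbert_dim L"
abbreviation "X \<equiv> \<lambda>p. xmask (2 ^ ancilla L p)"
abbreviation "Z \<equiv> \<lambda>p. zmul (bit_sign (ancilla L p))"
abbreviation "A \<equiv> \<lambda>p. xmask (star_mask L (vtx p))"
abbreviation "B \<equiv> \<lambda>p. zmul (plaquette_sign L (face p))"

sublocale stabilizer_hamiltonian "{..<L\<^sup>2}" X Z A B
  by (rule toric_stabilizer_hamiltonian[OF L_pos vtx face])

lemma represents_H1:
  "represents N (H1 L vtx face) (\<lambda>f. - (\<Sum>p<L\<^sup>2. X p f + X p (A p f) + Z p f + Z p (B p f)))"
  unfolding H1_def
  by (intro represents_uminus represents_mat_sum represents_add represents_JX represents_JZ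
      represents_mult[OF represents_JX represents_star_op]
      represents_mult[OF represents_JZ represents_plaquette_op] L_pos) auto

lemma represents_H2:
  "represents N (H2 L vtx face) (\<lambda>f. - (\<Sum>p<L\<^sup>2. X p f + Z p f + A p f + B p f))"
  unfolding H2_def
  by (intro represents_uminus represents_mat_sum represents_add
      represents_JX represents_JZ represents_star_op represents_plaquette_op L_pos) auto

lemma represents_H_interp: "represents N (H_interp L vtx face t) (Ham t)"
proof -
  have "Ham t = (\<lambda>f. (1 - t) *\<^sub>R - (\<Sum>p<L\<^sup>2. X p f + X p (A p f) + Z p f + Z p (B p f))
      + t *\<^sub>R - (\<Sum>p<L\<^sup>2. X p f + Z p f + A p f + B p f))"
    by (rule ext) (simp only: Ham_def scaleR_minus_right scaleR_right.sum scaleR_add_right sum.distrib minus_add_distrib)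
  then show ?thesis
    using represents_add[OF represents_smult[OF represents_H1, of "1 - t"] represents_smult[OF represents_H2, of t]]
    by (simp only: H_interp_def)
qed

lemma H_interp_carrier: "H_interp L vtx face t \<in> carrier_mat N N"
  using representsD(1)[OF represents_H_interp] .

lemma H_interp_0: "H_interp L vtx face 0 = H1 L vtx face"
  and H_interp_1: "H_interp L vtx face 1 = H2 L vtx face"
  using representsD(1)[OF represents_H1] representsD(1)[OF represents_H2]
  by (auto simp: H_interp_def)

lemma self_adjoint_H_interp: "self_adjoint (H_interp L vtx face t)"
proof (rule represents_self_adjoint[OF represents_H_interp])
  \<comment> \<open>Bit flips are symmetric because XOR with a mask is its own inverse; sign
    functions are real and diagonal. The products \<open>X p (A p f)\<close> and
    \<open>Z p (B p f)\<close> are again of these two kinds.\<close>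
  have mask: "xmask m (basis_amp j) i = cnj (xmask m (basis_amp i) j)" for m i j
  proof -
    have "i XOR m = j \<longleftrightarrow> j XOR m = i" by (metis xor.assoc xor_self_eq xor.right_neutral)
    then show ?thesis by (simp add: xmask_def basis_amp_def)
  qed
  have diag: "zmul s (basis_amp j) i = cnj (zmul s (basis_amp i) j)" for s i j
    by (simp add: zmul_def basis_amp_def)
  have ZB: "Z p (B p f) = zmul (\<lambda>i. bit_sign (ancilla L p) i * plaquette_sign L (face p) i) f" for p f
    by (simp add: zmul_def)
  show "Ham t (basis_amp j) i = cnj (Ham t (basis_amp i) j)" for i j
    unfolding Ham_def ZB xmask_xmask
    by (simp add: sum_fun_apply mask[of _ j i] diag[of _ j i])
qed

lemma ancilla_exp_less: "p < L\<^sup>2 \<Longrightarrow> (2::nat) ^ ancilla L p < N"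
  by (simp add: ancilla_def hilbert_dim_def num_qubits_def)

lemma star_mask_less: "star_mask L v < N"
  using edge_less[OF L_pos]
  by (auto simp: star_mask_def hilbert_dim_def num_qubits_def intro!: xor_lt_exp power_strict_increasing
      less_le_trans[OF edge_less(1)[OF L_pos]] less_le_trans[OF edge_less(2)[OF L_pos]] split: prod.split)

lemma supported_stabilized_state:
  obtains g where "stabilized g" "g \<noteq> 0" "\<forall>i\<ge>N. g i = 0"
proof -
  \<comment> \<open>Bit flips permute the amplitudes, so they preserve their sum.\<close>
  define total where "total f = (\<Sum>i<N. f i)" for f :: amplitudes
  have lin: "linear total"
    by (rule linearI) (simp_all add: total_def sum.distrib scaleR_right.sum)
  have tot: "total (xmask m f) = total f" if "m < N" for m f
    unfolding total_def xmask_def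
  proof (rule sum.reindex_bij_betw)
    show "bij_betw (\<lambda>i. i XOR m) {..<N} {..<N}"
      using that xor_lt_exp[of _ "num_qubits L" m]
      by (intro bij_betwI[where g="\<lambda>i. i XOR m"]) (auto simp: hilbert_dim_def xor.assoc)
  qed
  have "total (basis_amp 0) = 1"
    by (simp add: total_def basis_amp_def hilbert_dim_def)
  \<comment> \<open>The start is the computational state with all qubits zero: every sign function
    equals 1 at index 0.\<close>
  moreover have "zmul s (basis_amp 0) = basis_amp 0" if "s 0 = 1" for s
    using that by (auto simp: zmul_def basis_amp_def)
  ultimately have "\<exists>g. total g \<noteq> 0 \<and> stabilized g"
    using ancilla_exp_less star_mask_less
    by (intro stabilized_exists[of total "basis_amp 0", OF lin])
      (simp_all add: tot plaquette_sign_def bit_sign_def split: prod.split)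
  then obtain g where g: "total g \<noteq> 0" "stabilized g" by blast
  \<comment> \<open>Nothing is known about \<open>g\<close> beyond \<open>N\<close>, so it is cut
    off there. Since \<open>total\<close> looks only below \<open>N\<close>, the result is nonzero.
    It still satisfies the matrix eigenvalue equation for the ground energy, and
    \<open>ground_imp_stabilized\<close> makes it stabilized again.\<close>
  let ?v = "vec N g" and ?H = "H_interp L vtx face 0"
  have v: "?v \<noteq> 0\<^sub>v N"
    using g(1) by (auto simp: total_def vec_eq_iff intro: ccontr)
  have "Ham 0 g = E0 0 *\<^sub>R g" using Ham_stabilized[of 0 g] g(2) by simp
  then have "?H *\<^sub>v ?v = complex_of_real (E0 0) \<cdot>\<^sub>v ?v"
    using representsD(2)[OF represents_H_interp, of 0 g] by (auto simp: scaleR_conv_of_real)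
  then have "Ham 0 (extend0 N ?v) = E0 0 *\<^sub>R extend0 N ?v"
    using represents_eigen_iff[OF represents_H_interp, of ?v] by simp
  then have "stabilized (extend0 N ?v)" by (intro ground_imp_stabilized[of 0]) simp_all
  moreover have "extend0 N ?v \<noteq> 0" using v extend0_eq_0_iff[of ?v N] by simp
  ultimately show ?thesis using that[of "extend0 N ?v"] by (simp add: extend0_def)
qed

section \<open>Spectrum, gap and deformation\<close>

lemma supported_eigenvector:
  assumes "Ham t f = E *\<^sub>R f" "f \<noteq> 0" "\<forall>i\<ge>N. f i = 0"
  shows "E \<in> energies (H_interp L vtx face t)"
proof -
  have "extend0 N (vec N f) = f" using assms(3) by (auto simp: extend0_def)
  then show ?thesis
    using assms(1,2) extend0_eq_0_iff[of "vec N f" N]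
    unfolding energies_iff[OF represents_H_interp] by (intro bexI[of _ "vec N f"]) auto
qed

lemma energies_bounds:
  assumes t: "0 \<le> t" "t \<le> 1"
  shows "E0 t \<in> energies (H_interp L vtx face t)"
    and "\<exists>E \<in> energies (H_interp L vtx face t). E \<noteq> E0 t"
    and "E \<in> energies (H_interp L vtx face t) \<Longrightarrow> E = E0 t \<or> E \<ge> E0 t + 4 * (sqrt 2 - 1)"
proof -
  obtain g where g: "stabilized g" "g \<noteq> 0" "\<forall>i\<ge>N. g i = 0" by (rule supported_stabilized_state)
  show "E0 t \<in> energies (H_interp L vtx face t)"
    using supported_eigenvector[OF Ham_stabilized[OF t(2) g(1)] g(2,3)] .
  have 0: "0 \<in> {..<L\<^sup>2}" using L_pos by simp
  have "\<forall>i\<ge>N. X 0 (Z 0 g) i = 0"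
    using g(3) representsD(3)[OF represents_JX] representsD(3)[OF represents_JZ] 0 by blast
  then show "\<exists>E \<in> energies (H_interp L vtx face t). E \<noteq> E0 t"
    using excited_state[OF t(2) g(1,2) 0] supported_eigenvector by blast
  show "E = E0 t \<or> E \<ge> E0 t + 4 * (sqrt 2 - 1)" if "E \<in> energies (H_interp L vtx face t)"
    using that energies_iff[OF represents_H_interp] energy_cases[OF t] extend0_eq_0_iff by metis
qed

lemma ground_energy_H_interp:
  assumes t: "0 \<le> t" "t \<le> 1"
  shows "ground_energy (H_interp L vtx face t) = E0 t"
  unfolding ground_energy_def
proof (rule Min_eqI)
  show "E0 t \<le> E" if "E \<in> energies (H_interp L vtx face t)" for E
    using energies_bounds(3)[OF t that] sqrt2_bounds(1) by (auto simp: field_simps)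
qed (rule finite_energies[OF H_interp_carrier] energies_bounds(1)[OF t])+

text \<open>The right-hand side does not mention \<open>t\<close>, which is what identifies the
  ground spaces along the whole path.\<close>

lemma ground_space_H_interp:
  assumes t: "0 \<le> t" "t \<le> 1"
  shows "ground_space (H_interp L vtx face t) = {v \<in> carrier_vec N. stabilized (extend0 N v)}"
  using H_interp_carrier[of t] represents_eigen_iff[OF represents_H_interp[of t]]
    Ham_stabilized[OF t(2)] ground_imp_stabilized[OF t]
  by (auto simp: ground_space_def ground_energy_H_interp[OF t])

lemma gap_H_interp:
  assumes t: "0 \<le> t" "t \<le> 1"
  shows "gap_at_least (4 * (sqrt 2 - 1)) (H_interp L vtx face t)"
proof -
  let ?X = "excited_energies (H_interp L vtx face t)"
  have X: "?X = energies (H_interp L vtx face t) - {E0 t}"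
    by (simp add: excited_energies_def ground_energy_H_interp[OF t])
  have ne: "?X \<noteq> {}" using energies_bounds(2)[OF t] unfolding X by blast
  have "Min ?X \<in> ?X"
    using ne finite_energies[OF H_interp_carrier] unfolding X by (intro Min_in) auto
  then have "Min ?X \<ge> E0 t + 4 * (sqrt 2 - 1)" using energies_bounds(3)[OF t] unfolding X by blast
  then show ?thesis using ne by (simp add: gap_at_least_def energy_gap_def ground_energy_H_interp[OF t])
qed

lemma deformable: "deformable_without_closing_gap (H1 L vtx face) (H2 L vtx face)"
  unfolding deformable_without_closing_gap_def
proof (intro exI conjI ballI allI impI)
  show "H_interp L vtx face s \<in> carrier_mat N N" "self_adjoint (H_interp L vtx face s)" for s
    by (rule H_interp_carrier self_adjoint_H_interp)+
  show "H_interp L vtx face 0 = H1 L vtx face" "H_interp L vtx face 1 = H2 L vtx face"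
    by (rule H_interp_0 H_interp_1)+
  show "4 * (sqrt 2 - 1) > (0::real)" using sqrt2_bounds by simp
  show "gap_at_least (4 * (sqrt 2 - 1)) (H_interp L vtx face s)" if "s \<in> {0..1}" for s
    using that gap_H_interp by simp
  fix i j assume "i < N" "j < N"
  then have "(\<lambda>s. H_interp L vtx face s $$ (i, j)) =
      (\<lambda>s. complex_of_real (1 - s) * H1 L vtx face $$ (i, j) + complex_of_real s * H2 L vtx face $$ (i, j))"
    using representsD(1)[OF represents_H1] representsD(1)[OF represents_H2]
    by (auto simp: H_interp_def fun_eq_iff)
  then show "continuous_on {0..1} (\<lambda>s. H_interp L vtx face s $$ (i, j))"
    by (simp only:) (intro continuous_intros)
qed

end

theorem mainTheorem4:
  fixes L :: nat and vtx face :: "nat \<Rightarrow> nat \<times> nat"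
  assumes "L \<ge> 2"
    and "bij_betw vtx {..<L\<^sup>2} ({..<L} \<times> {..<L})"
    and "bij_betw face {..<L\<^sup>2} ({..<L} \<times> {..<L})"
  shows "ground_space (H1 L vtx face) = ground_space (H2 L vtx face) \<and>
    (\<forall>t::real. 0 \<le> t \<and> t \<le> 1 \<longrightarrow>
      ground_space (H_interp L vtx face t) = ground_space (H1 L vtx face) \<and>
      gap_at_least (4 * (sqrt 2 - 1)) (H_interp L vtx face t)) \<and>
    deformable_without_closing_gap (H1 L vtx face) (H2 L vtx face)"
proof -
  interpret toric_code L vtx face
    using assms by unfold_locales auto
  have "ground_space (H_interp L vtx face t) = ground_space (H1 L vtx face)" if "0 \<le> t" "t \<le> 1" for t
    using ground_space_H_interp[OF that] ground_space_H_interp[of 0] by (simp add: H_interp_0)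
  then show ?thesis using gap_H_interp deformable by (metis H_interp_1 zero_le_one order_refl)
qed

end
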